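(* (Wick's theorem) Let $W=(a^{\vartheta_n}_{c_n},\dots,a^{\vartheta_1}_{c_1})$ be an admissible sequence and let $M=a^{\vartheta_n}_{c_n}\cdots a^{\vartheta_1}_{c_1}$ be the corresponding monomial. Then $$M=\sum_{\mathfrak p\in\mathfrak P(W)}\lfloor W\rfloor_{\mathfrak p},$$ as operators on measure valued finite particle vectors, i.e. $M\Phi_\upsilon=\sum_{\mathfrak p\in\mathfrak P(W)}\lfloor W\rfloor_{\mathfrak p}\Phi_\upsilon$ for every finite index set $\upsilon$ disjoint from $\{c_1,\dots,c_n\}$.
   Context: $X$ is a locally compact space, countable at infinity, $\mathfrak X=\{\emptyset\}+X+X^2+\cdots$ (disjoint union). Indices $b,c,\dots$ label variables $x_b,x_c,\dots\in X$; for a finite index set $\alpha$, $x_\alpha=(x_c)_{c\in\alpha}$; $+$ between index sets means disjoint union, and $\alpha+c$, $\alpha\setminus c$ stand for $\alpha+\{c\}$, $\alpha\setminus\{c\}$. $\varepsilon_x$ is the point measure at $x$ and $\varepsilon(b,c)=\varepsilon_{x_b}(dx_c)$. Products of point measures. Let $S=\{(b_i,c_i):i\in I\}$ be a finite set of pairs of indices, the $b_i$ pairwise different, the $c_i$ pairwise different, $b_i\ne c_i$; $S_-=\{b_i\}$, $S_+=\{c_i\}$. Make $S$ an oriented graph by $(b,c)\triangleright(b',c')\iff c=b'$. If $S$ has no circuits, each $p\in S_-\setminus S_+$ starts a maximal chain $(p,c_{p,1}),(c_{p,1},c_{p,2}),\dots,(c_{p,k-1},c_{p,k})$; put $\pi_p=\{c_{p,1},\dots,c_{p,k}\}$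 and define $E_S=\prod_{i\in I}\varepsilon(b_i,c_i):=\prod_{p\in S_-\setminus S_+}\varepsilon_{x_p}^{\otimes\#\pi_p}(dx_{\pi_p})$, a measure in the variables $x_c$, $c\in S_+$, depending on $x_p$, $p\in S_-\setminus S_+$ (and $E_\emptyset=1$). Finite particle vectors. For a finite index set $\sigma$, $\Phi_\sigma$ is the measure valued function on $\mathfrak X$ given, for index sets $\upsilon$ disjoint from $\sigma$, by $\Phi_\sigma(x_\upsilon)=\sum_h\prod_{b\in\sigma}\varepsilon(h(b),b)$, the sum being over bijections $h:\sigma\to\upsilon$, if $\#\sigma=\#\upsilon$, and $0$ otherwise. If $\sigma\cap S_+=\emptyset$ and $S$ has no circuits, $\Phi_\sigma E_S$ is defined by $(\Phi_\sigma E_S)(x_\upsilon)=\sum_h\prod_{b\in\sigma}\varepsilon(h(b),b)\prod_{i}\varepsilon(b_i,c_i)$ (the sum being over bijections $h:\sigma\to\upsilon$, and the product of point measures in the term belonging to $h$ being the measure $E_{S_h}$ for the circuit-free set of pairs $S_h=\{(h(b),b):b\in\sigma\}\cup S$, i.e. $E_{S_h}=\prod_p\varepsilon_{x_p}^{\otimes\#\pi_p}(dx_{\pi_p})$ with $p$ running through the starting points of the maximal chains of $S_h$ and $\pi_p$ the set of the further indices of the chain starting at $p$; $\upsilon$ disjoint from $\sigma\cup S_+\cup S_-$). Put $\pi=S_++\sigma$, $\varrho=S_-\setminus(S_++\sigma)$. Creation and annihilation operators act by $$a_c^+(\Phi_\sigma E_S)=\Phi_{\sigma+c}E_S\ (c\notin\pi),\qquad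 a_c(\Phi_\sigma E_S)=\sum_{b\in\sigma}\varepsilon(c,b)\Phi_{\sigma\setminus b}E_S\ (c\notin\pi+\varrho),$$ extended to finite sums. Admissible sequences. Write $a_c^{+1}=a_c^+$, $a_c^{-1}=a_c$. A sequence $W=(a^{\vartheta_n}_{c_n},\dots,a^{\vartheta_1}_{c_1})$, $\vartheta_i=\pm1$, is admissible if for all $i>j$ either $c_i\ne c_j$, or $c_i=c_j$, $\vartheta_i=1$, $\vartheta_j=-1$. $\mathfrak P(W)$ is the set of all decompositions $\mathfrak p=\{\mathfrak p_+,\mathfrak p_-,\{q_i,r_i\}_{i\in I}\}$ of $[1,n]=\{1,\dots,n\}$, $[1,n]=\mathfrak p_++\mathfrak p_-+\sum_{i\in I}\{q_i,r_i\}$, with $\vartheta_s=+1$ for $s\in\mathfrak p_+$, $\vartheta_s=-1$ for $s\in\mathfrak p_-$, $\vartheta_{q_i}=-1$, $\vartheta_{r_i}=+1$ and $q_i>r_i$. For $\mathfrak p\in\mathfrak P(W)$, $$\lfloor W\rfloor_{\mathfrak p}=\prod_{s\in\mathfrak p_+}a^+_{c_s}\prod_{i\in I}\varepsilon(c_{q_i},c_{r_i})\prod_{t\in\mathfrak p_-}a_{c_t}.$$ With $\sigma=\{c_s:s\in\mathfrak p_+\}$, $\tau=\{c_t:t\in\mathfrak p_-\}$, $S=\{(c_{q_i},c_{r_i}):i\in I\}$, this operator acts by $\lfloor W\rfloor_{\mathfrak p}\Phi_\upsilon=\sum_{\upsilon_1+\upsilon_2=\upsilon}\ \sum_{h:\tau\to\upsilon_1\text{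 bijective}}\ \prod_{t\in\tau}\varepsilon(t,h(t))\,\Phi_{\sigma+\upsilon_2}\,E_S$ (all the graphs of pairs occurring here are without circuits). *)

theory Defs
  imports "HOL-Probability.Probability"
begin

definition countable_at_infinity :: "'x::topological_space itself \<Rightarrow> bool" where
  "countable_at_infinity _ \<longleftrightarrow>
     (\<exists>K :: nat \<Rightarrow> 'x set. (\<forall>m. compact (K m)) \<and> (\<Union>m. K m) = UNIV)"

section \<open>Products of point measures\<close>

text \<open>
  A pair \<open>(b, c)\<close> stands for the kernel \<open>\<epsilon>(b, c) = \<epsilon>_{x_b}(dx_c)\<close>.  A set of pairs is simply a
  relation on indices, with \<open>S_- = Domain S\<close> and \<open>S_+ = Range S\<close>; the absence of circuits is
  \<^const>\<open>acyclic\<close>.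
\<close>

definition pair_set :: "('i \<times> 'i) set \<Rightarrow> bool" where
  "pair_set S \<longleftrightarrow> finite S \<and> inj_on fst S \<and> inj_on snd S \<and> (\<forall>(b, c)\<in>S. b \<noteq> c)"

text \<open>The chain starting at \<open>p\<close> runs through the indices \<open>S\<^sup>+ `` {p}\<close> (this is the set \<open>\<pi>_p\<close>).\<close>

definition chain_start :: "('i \<times> 'i) set \<Rightarrow> 'i \<Rightarrow> 'i" where
  "chain_start S c = (THE p. p \<in> Domain S - Range S \<and> c \<in> S\<^sup>+ `` {p})"

text \<open>
  \<open>E_S\<close> puts the factor \<open>\<epsilon>_{x_p}(dx_c)\<close> on every \<open>c \<in> \<pi>_p\<close>.  The sets \<open>\<pi>_p\<close> partition \<open>Range S\<close>, so
  the product over \<open>p\<close> of the tensor powers is written as one product over \<open>Range S\<close>.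
  The argument \<open>x\<close> assigns a point to every index, but only the values at
  \<open>Domain S - Range S\<close> matter.
\<close>

definition E :: "('i \<times> 'i) set \<Rightarrow> ('i \<Rightarrow> 'x::topological_space) \<Rightarrow> ('i \<Rightarrow> 'x) measure" where
  "E S x = (\<Pi>\<^sub>M c\<in>Range S. return borel (x (chain_start S c)))"

section \<open>Measure valued finite particle vectors\<close>

definition measure_sum :: "'a measure \<Rightarrow> 'j set \<Rightarrow> ('j \<Rightarrow> 'a measure) \<Rightarrow> 'a measure" where
  "measure_sum N J \<mu> = measure_of (space N) (sets N) (\<lambda>A. \<Sum>j\<in>J. emeasure (\<mu> j) A)"

text \<open>
  A vector records the set \<open>\<pi>\<close> of the variables of its measures and the set \<open>\<rho>\<close> of its
  parameters.  Its value at a finite index set \<open>\<upsilon>\<close> disjoint from \<open>\<pi> \<union> \<rho>\<close> is a measure in the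
  variables \<open>x_c\<close>, \<open>c \<in> \<pi>\<close>, that depends on \<open>x_b\<close>, \<open>b \<in> \<upsilon> \<union> \<rho>\<close>.  For other \<open>\<upsilon>\<close> the value is
  \<^const>\<open>undefined\<close>, so that equality of vectors is equality on the proper domain.
\<close>

datatype ('i, 'x) mvec =
  MVec (vars: "'i set") (params: "'i set")
       (val: "'i set \<Rightarrow> ('i \<Rightarrow> 'x) \<Rightarrow> ('i \<Rightarrow> 'x) measure")

definition mvec_on ::
    "'i set \<Rightarrow> 'i set \<Rightarrow> ('i set \<Rightarrow> ('i \<Rightarrow> 'x) \<Rightarrow> ('i \<Rightarrow> 'x) measure) \<Rightarrow> ('i, 'x) mvec" where
  "mvec_on \<pi> \<rho> F =
     MVec \<pi> \<rho> (\<lambda>\<upsilon> x. if finite \<upsilon> \<and> \<upsilon> \<inter> (\<pi> \<union> \<rho>) = {} then F \<upsilon> x else undefined)"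

text \<open>
  Finite sums of vectors with variables \<open>\<pi>\<close> and parameters \<open>\<rho>\<close>; these two sets are arguments
  because they are not determined by an empty family.
\<close>

definition mvec_sum ::
    "'i set \<Rightarrow> 'i set \<Rightarrow> 'j set \<Rightarrow> ('j \<Rightarrow> ('i, 'x::topological_space) mvec) \<Rightarrow> ('i, 'x) mvec" where
  "mvec_sum \<pi> \<rho> J \<Psi> =
     mvec_on \<pi> \<rho> (\<lambda>\<upsilon> x. measure_sum (\<Pi>\<^sub>M c\<in>\<pi>. borel) J (\<lambda>j. val (\<Psi> j) \<upsilon> x))"

definition bijections :: "'a set \<Rightarrow> 'b set \<Rightarrow> ('a \<Rightarrow> 'b) set" where
  "bijections A B = {h \<in> A \<rightarrow>\<^sub>E B. bij_betw h A B}"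

definition PhiE :: "'i set \<Rightarrow> ('i \<times> 'i) set \<Rightarrow> ('i, 'x::topological_space) mvec" where
  "PhiE \<sigma> S =
     (let \<pi> = Range S \<union> \<sigma>; \<rho> = Domain S - (Range S \<union> \<sigma>) in
      mvec_on \<pi> \<rho> (\<lambda>\<upsilon> x.
        measure_sum (\<Pi>\<^sub>M c\<in>\<pi>. borel) (bijections \<sigma> \<upsilon>) (\<lambda>h. E ((\<lambda>b. (h b, b)) ` \<sigma> \<union> S) x)))"

abbreviation Phi :: "'i set \<Rightarrow> ('i, 'x::topological_space) mvec" where
  "Phi \<sigma> \<equiv> PhiE \<sigma> {}"

definition PhiE_term :: "'i set \<Rightarrow> 'i set \<Rightarrow> 'i set \<Rightarrow> ('i \<times> 'i) set \<Rightarrow> bool" where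
  "PhiE_term \<pi> \<rho> \<sigma> S \<longleftrightarrow>
     finite \<sigma> \<and> pair_set S \<and> acyclic S \<and> \<sigma> \<inter> Range S = {} \<and>
     \<pi> = Range S \<union> \<sigma> \<and> \<rho> = Domain S - (Range S \<union> \<sigma>)"

section \<open>Creation and annihilation operators\<close>

text \<open>
  The operators are given by their action on the \<open>\<Phi>_\<sigma> E_S\<close> and extended to finite sums: the image of
  \<open>\<Psi>\<close> is read off from any representation of \<open>\<Psi>\<close> as a finite sum.  The result does not depend on
  the representation, since
  \<open>(a_c \<Psi>)(x_\<upsilon>) = \<Psi>(x_{\<upsilon> + c})\<close> and
  \<open>(a\<^sup>+_c \<Psi>)(x_\<upsilon>) = \<Sum>b\<in>\<upsilon>. \<epsilon>(b, c) \<Psi>(x_{\<upsilon> \<setminus> b})\<close>.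
  The product \<open>\<epsilon>(c, b) \<Phi>_{\<sigma> \<setminus> b} E_S\<close> is \<open>\<Phi>_{\<sigma> \<setminus> b} E_{S'}\<close> with \<open>S' = S + (c, b)\<close>.
\<close>

definition creation_image ::
    "'i \<Rightarrow> ('i, 'x::topological_space) mvec \<Rightarrow> ('i, 'x) mvec \<Rightarrow> bool" where
  "creation_image c \<Psi> \<Psi>' \<longleftrightarrow>
     (\<exists>\<pi> \<rho> m \<sigma> S.
        finite \<pi> \<and> finite \<rho> \<and> \<pi> \<inter> \<rho> = {} \<and> c \<notin> \<pi> \<and>
        (\<forall>j<m::nat. PhiE_term \<pi> \<rho> (\<sigma> j) (S j)) \<and>
        \<Psi> = mvec_sum \<pi> \<rho> {..<m} (\<lambda>j. PhiE (\<sigma> j) (S j)) \<and>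
        \<Psi>' = mvec_sum (\<pi> \<union> {c}) (\<rho> - {c}) {..<m} (\<lambda>j. PhiE (\<sigma> j \<union> {c}) (S j)))"

definition annihilation_image ::
    "'i \<Rightarrow> ('i, 'x::topological_space) mvec \<Rightarrow> ('i, 'x) mvec \<Rightarrow> bool" where
  "annihilation_image c \<Psi> \<Psi>' \<longleftrightarrow>
     (\<exists>\<pi> \<rho> m \<sigma> S.
        finite \<pi> \<and> finite \<rho> \<and> \<pi> \<inter> \<rho> = {} \<and> c \<notin> \<pi> \<union> \<rho> \<and>
        (\<forall>j<m::nat. PhiE_term \<pi> \<rho> (\<sigma> j) (S j)) \<and>
        \<Psi> = mvec_sum \<pi> \<rho> {..<m} (\<lambda>j. PhiE (\<sigma> j) (S j)) \<and>
        \<Psi>' = mvec_sum \<pi> (\<rho> \<union> {c}) {..<m} (\<lambda>j.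
               mvec_sum \<pi> (\<rho> \<union> {c}) (\<sigma> j) (\<lambda>b. PhiE (\<sigma> j - {b}) (S j \<union> {(c, b)}))))"

definition creation :: "'i \<Rightarrow> ('i, 'x::topological_space) mvec \<Rightarrow> ('i, 'x) mvec" where
  "creation c \<Psi> = (THE \<Psi>'. creation_image c \<Psi> \<Psi>')"

definition annihilation :: "'i \<Rightarrow> ('i, 'x::topological_space) mvec \<Rightarrow> ('i, 'x) mvec" where
  "annihilation c \<Psi> = (THE \<Psi>'. annihilation_image c \<Psi> \<Psi>')"

section \<open>Monomials and their decompositions\<close>

text \<open>
  A sequence \<open>W = (a^{\<theta>_n}_{c_n}, \<dots>, a^{\<theta>_1}_{c_1})\<close> is given by \<open>n\<close> and the functions \<open>\<theta>\<close>, \<open>c\<close>,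
  of which only the values on \<open>{1..n}\<close> matter.
\<close>

definition ladder :: "int \<Rightarrow> 'i \<Rightarrow> ('i, 'x::topological_space) mvec \<Rightarrow> ('i, 'x) mvec" where
  "ladder s c = (if s = 1 then creation c else annihilation c)"

fun monomial ::
    "nat \<Rightarrow> (nat \<Rightarrow> int) \<Rightarrow> (nat \<Rightarrow> 'i) \<Rightarrow> ('i, 'x::topological_space) mvec \<Rightarrow> ('i, 'x) mvec" where
  "monomial 0 \<theta> c \<Psi> = \<Psi>"
| "monomial (Suc n) \<theta> c \<Psi> = ladder (\<theta> (Suc n)) (c (Suc n)) (monomial n \<theta> c \<Psi>)"

definition admissible :: "nat \<Rightarrow> (nat \<Rightarrow> int) \<Rightarrow> (nat \<Rightarrow> 'i) \<Rightarrow> bool" where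
  "admissible n \<theta> c \<longleftrightarrow>
     (\<forall>i\<in>{1..n}. \<forall>j\<in>{1..n}. i > j \<longrightarrow> c i \<noteq> c j \<or> (c i = c j \<and> \<theta> i = 1 \<and> \<theta> j = -1))"

text \<open>
  A decomposition is a triple \<open>(A, B, Q)\<close> with \<open>A = \<pp>_+\<close>, \<open>B = \<pp>_-\<close> and \<open>Q\<close> the set of the pairs
  \<open>(q_i, r_i)\<close>.
\<close>

definition decompositions ::
    "nat \<Rightarrow> (nat \<Rightarrow> int) \<Rightarrow> (nat set \<times> nat set \<times> (nat \<times> nat) set) set" where
  "decompositions n \<theta> = {(A, B, Q).
     A \<union> B \<union> (\<Union>(q, r)\<in>Q. {q, r}) = {1..n} \<and>
     A \<inter> B = {} \<and>
     (\<forall>(q, r)\<in>Q. {q, r} \<inter> (A \<union> B) = {}) \<and>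
     (\<forall>(q, r)\<in>Q. \<forall>(q', r')\<in>Q. (q, r) \<noteq> (q', r') \<longrightarrow> {q, r} \<inter> {q', r'} = {}) \<and>
     (\<forall>s\<in>A. \<theta> s = 1) \<and> (\<forall>s\<in>B. \<theta> s = -1) \<and>
     (\<forall>(q, r)\<in>Q. \<theta> q = -1 \<and> \<theta> r = 1 \<and> q > r)}"

text \<open>The vector \<open>\<lfloor>W\<rfloor>_\<pp> \<Phi>_\<upsilon>\<close>.\<close>

definition wick_term ::
    "(nat \<Rightarrow> 'i) \<Rightarrow> nat set \<times> nat set \<times> (nat \<times> nat) set \<Rightarrow> 'i set
       \<Rightarrow> ('i, 'x::topological_space) mvec" where
  "wick_term c = (\<lambda>(A, B, Q) \<upsilon>.
     let \<sigma> = c ` A; \<tau> = c ` B; S = (\<lambda>(q, r). (c q, c r)) ` Q;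
         \<pi> = \<sigma> \<union> \<upsilon> \<union> Range S; \<rho> = (\<tau> \<union> Domain S) - \<pi>
     in mvec_sum \<pi> \<rho> {(\<upsilon>\<^sub>1, \<upsilon>\<^sub>2). \<upsilon>\<^sub>1 \<union> \<upsilon>\<^sub>2 = \<upsilon> \<and> \<upsilon>\<^sub>1 \<inter> \<upsilon>\<^sub>2 = {}} (\<lambda>(\<upsilon>\<^sub>1, \<upsilon>\<^sub>2).
          mvec_sum \<pi> \<rho> (bijections \<tau> \<upsilon>\<^sub>1) (\<lambda>h.
            PhiE (\<sigma> \<union> \<upsilon>\<^sub>2) ((\<lambda>t. (t, h t)) ` \<tau> \<union> S))))"

text \<open>
  The variables and parameters of \<open>M \<Phi>_\<upsilon>\<close> and of all \<open>\<lfloor>W\<rfloor>_\<pp> \<Phi>_\<upsilon>\<close>: the indices \<open>c_i\<close> with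
  \<open>\<theta>_i = 1\<close> join \<open>\<upsilon>\<close> as variables, the remaining ones are parameters.
\<close>

definition wick_vars :: "nat \<Rightarrow> (nat \<Rightarrow> int) \<Rightarrow> (nat \<Rightarrow> 'i) \<Rightarrow> 'i set \<Rightarrow> 'i set" where
  "wick_vars n \<theta> c \<upsilon> = \<upsilon> \<union> c ` {i \<in> {1..n}. \<theta> i = 1}"

definition wick_params :: "nat \<Rightarrow> (nat \<Rightarrow> int) \<Rightarrow> (nat \<Rightarrow> 'i) \<Rightarrow> 'i set \<Rightarrow> 'i set" where
  "wick_params n \<theta> c \<upsilon> = c ` {i \<in> {1..n}. \<theta> i = -1} - wick_vars n \<theta> c \<upsilon>"

end

theory Submission imports Defs begin

text \<open>
  The measure \<open>E_S\<close> is the point measure at the family \<open>x_{p(c)}\<close>, where \<open>p(c)\<close> is the root of the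
  chain through \<open>c\<close>.  Hence \<open>a_c\<close> and \<open>a\<^sup>+_c\<close> are well defined on finite sums: \<open>(a_c \<Psi>)(x_\<upsilon>)\<close> is
  \<open>\<Psi>(x_{\<upsilon> + c})\<close>, and \<open>(a\<^sup>+_c \<Psi>)(x_\<upsilon>)\<close> is the sum over \<open>b \<in> \<upsilon>\<close> of the images of \<open>\<Psi>(x_{\<upsilon> \<setminus> b})\<close>,
  taken at the parameter \<open>x_c := x_b\<close>, under the insertion of the coordinate \<open>x_c = x_b\<close>.

  Both sides of Wick's theorem equal the sum of \<open>\<Phi>_{V \<setminus> S_+} E_S\<close> over all relations \<open>S\<close> that contract
  every annihilator with an earlier creator or an index of \<open>\<upsilon>\<close>, where \<open>V\<close> is \<open>\<upsilon>\<close> together with the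
  created indices.  For the monomial this is an induction on its length: a creator adds its index to
  \<open>V\<close> and leaves the relations unchanged, an annihilator is contracted with any free element of \<open>V\<close>.
  For the right-hand side, a decomposition together with \<open>\<upsilon>\<^sub>1\<close>, \<open>\<upsilon>\<^sub>2\<close> and \<open>h\<close> can be recovered from \<open>S\<close>.
\<close>

section \<open>Products of point measures as point measures\<close>

text \<open>Injectivity of \<open>snd\<close> gives every index at most one predecessor, so a chain
  into \<open>e\<close> must pass through the predecessor \<open>z\<close>. Well-founded induction
  walks back along \<open>S\<close>: either \<open>z\<close> is a target and hands its root on, or
  \<open>z\<close> is the root itself.\<close>

lemma ex1_chain_start:
  assumes "wf S" "inj_on snd S" "e \<in> Range S"
  shows "\<exists>!p. p \<in> Domain S - Range S \<and> e \<in> S\<^sup>+ `` {p}"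
  using assms(1,3)
proof (induction e rule: wf_induct_rule)
  case (less e)
  then obtain z where z: "(z, e) \<in> S" by auto
  have pred: "z' = z" if "(z', e) \<in> S" for z'
    using inj_onD[OF assms(2), of "(z', e)" "(z, e)"] that z by auto
  show ?case
  proof (cases "z \<in> Range S")
    case True
    then obtain p where p: "p \<in> Domain S - Range S" "(p, z) \<in> S\<^sup>+"
      and uniq: "\<And>p'. p' \<in> Domain S - Range S \<Longrightarrow> (p', z) \<in> S\<^sup>+ \<Longrightarrow> p' = p"
      using less.IH[OF z True] by (elim ex1E) (simp, blast)
    have uniq': "p' = p" if "p' \<in> Domain S - Range S" "(p', e) \<in> S\<^sup>+" for p'
    proof -
      obtain z' where "(p', z') \<in> S\<^sup>*" "(z', e) \<in> S"
        using \<open>(p', e) \<in> S\<^sup>+\<close> by (meson tranclD2)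
      then have "(p', z) \<in> S\<^sup>*" using pred by blast
      then show ?thesis using uniq that(1) True by (metis DiffD2 rtranclD)
    qed
    have "(p, e) \<in> S\<^sup>+" using p(2) z by (rule trancl_into_trancl)
    then show ?thesis using p(1) uniq' by (metis Image_singleton_iff)
  next
    case False
    have "p' = z" if "(p', e) \<in> S\<^sup>+" for p'
    proof -
      obtain z' where "(p', z') \<in> S\<^sup>*" "(z', e) \<in> S"
        using \<open>(p', e) \<in> S\<^sup>+\<close> by (meson tranclD2)
      then have "(p', z) \<in> S\<^sup>*" using pred by blast
      then show ?thesis using False by (metis rtranclE RangeI)
    qed
    moreover have "z \<in> Domain S" using z by blast
    ultimately show ?thesis using z False by (metis DiffI Image_singleton_iff r_into_trancl')
  qed
qed

text \<open>Uniqueness of the root turns the definite description in \<open>chain_start\<close> into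
  a recursion along \<open>S\<close>.\<close>

lemma chain_start_step:
  assumes "wf S" "inj_on snd S" "(z, e) \<in> S"
  shows "chain_start S e = (if z \<in> Range S then chain_start S z else z)"
proof -
  have e: "e \<in> Range S" using assms(3) by blast
  have "p \<in> Domain S - Range S \<and> e \<in> S\<^sup>+ `` {p}"
    if "p = (if z \<in> Range S then chain_start S z else z)" for p
  proof (cases "z \<in> Range S")
    case True
    then show ?thesis
      using theI'[OF ex1_chain_start[OF assms(1,2) True]] that assms(3)
      by (auto simp: chain_start_def)
  qed (use that assms(3) in auto)
  then show ?thesis
    unfolding chain_start_def[of S e]
    by (intro the1_equality[OF ex1_chain_start[OF assms(1,2) e]]) blast
qed

text \<open>Extended by \<open>x e\<close> to the indices outside \<open>Range S\<close>, so that
  the value is constant along every edge, including the first edge of a chain.\<close>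

definition root_value :: "('i \<times> 'i) set \<Rightarrow> ('i \<Rightarrow> 'x) \<Rightarrow> 'i \<Rightarrow> 'x" where
  "root_value S x e = (if e \<in> Range S then x (chain_start S e) else x e)"

lemma root_value_step:
  "wf S \<Longrightarrow> inj_on snd S \<Longrightarrow> (z, e) \<in> S \<Longrightarrow> root_value S x e = root_value S x z"
  by (auto simp: root_value_def chain_start_step)

lemma root_value_root: "e \<notin> Range S \<Longrightarrow> root_value S x e = x e"
  by (simp add: root_value_def)

text \<open>As \<open>c\<close> is no target of \<open>S\<close>, the new edge puts \<open>b\<close>
  in front of the chain starting at \<open>c\<close>, if there is one. Its members then take the
  value \<open>x b\<close>, just as if the parameter \<open>x_c\<close> had been set to
  \<open>x_b\<close>. This handles the creation of an index that already occurs as a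
  parameter.\<close>

lemma root_value_insert:
  assumes "wf S" "wf (insert (b, c) S)" "inj_on snd (insert (b, c) S)"
    and "c \<notin> Range S" "b \<notin> Range S" "b \<noteq> c"
  shows "root_value (insert (b, c) S) x e = root_value S (x(c := x b)) e"
  using assms(1)
proof (induction e rule: wf_induct_rule)
  case (less e)
  have inj: "inj_on snd S" using assms(3) by (rule inj_on_subset) auto
  show ?case
  proof (cases "e \<in> Range S")
    case True
    then obtain z where z: "(z, e) \<in> S" by auto
    then show ?thesis
      using less.IH[OF z] root_value_step[OF assms(1) inj z, of "x(c := x b)"]
        root_value_step[OF assms(2,3), of z e x] by (simp del: fun_upd_apply)
  next
    case False
    show ?thesis
    proof (cases "e = c")
      case True
      then show ?thesis
        using root_value_step[OF assms(2,3), of b c] False assms(5,6)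
        by (simp add: root_value_root)
    qed (use False in \<open>simp add: root_value_root\<close>)
  qed
qed

text \<open>A finite product of point measures is the point measure at the family of the points; in
  a T1 space singletons are closed, hence Borel.\<close>

lemma E_eq_return:
  fixes x :: "'i \<Rightarrow> 'x::t1_space"
  assumes "finite S"
  shows "E S x = return (\<Pi>\<^sub>M c\<in>Range S. borel) (restrict (root_value S x) (Range S))"
proof -
  have "E S x = return (\<Pi>\<^sub>M c\<in>Range S. borel) (restrict (\<lambda>c. x (chain_start S c)) (Range S))"
    unfolding E_def by (rule PiM_return) (use assms in \<open>auto simp: finite_Range\<close>)
  also have "restrict (\<lambda>c. x (chain_start S c)) (Range S) = restrict (root_value S x) (Range S)"
    by (auto simp: root_value_def restrict_def)
  finally show ?thesis .
qed

section \<open>Sums of measure valued vectors\<close>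

lemma space_measure_sum [simp]: "space (measure_sum N J \<mu>) = space N"
  and sets_measure_sum [simp]: "sets (measure_sum N J \<mu>) = sets N"
  by (simp_all add: measure_sum_def space_measure_of sets.space_closed)

text \<open>\<open>measure_of\<close> keeps a set function only if it is countably additive on the
  sigma-algebra; this holds here because the sum over \<open>J\<close> commutes with the
  series.\<close>

lemma emeasure_measure_sum:
  assumes "\<And>j. j \<in> J \<Longrightarrow> sets (\<mu> j) = sets N" "A \<in> sets N"
  shows "emeasure (measure_sum N J \<mu>) A = (\<Sum>j\<in>J. emeasure (\<mu> j) A)"
  unfolding measure_sum_def
proof (rule emeasure_measure_of_sigma)
  show "countably_additive (sets N) (\<lambda>A. \<Sum>j\<in>J. emeasure (\<mu> j) A)"
  proof (rule countably_additiveI)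
    fix B :: "nat \<Rightarrow> _" assume B: "range B \<subseteq> sets N" "disjoint_family B"
    have "(\<Sum>i. \<Sum>j\<in>J. emeasure (\<mu> j) (B i)) = (\<Sum>j\<in>J. \<Sum>i. emeasure (\<mu> j) (B i))"
      by (rule suminf_sum) simp
    also have "\<dots> = (\<Sum>j\<in>J. emeasure (\<mu> j) (\<Union>i. B i))"
      using B assms(1) by (intro sum.cong refl suminf_emeasure) auto
    finally show "(\<Sum>i. \<Sum>j\<in>J. emeasure (\<mu> j) (B i)) = (\<Sum>j\<in>J. emeasure (\<mu> j) (\<Union>i. B i))" .
  qed
qed (auto simp: sets.sigma_algebra_axioms positive_def assms)

lemma measure_sum_cong:
  "J = J' \<Longrightarrow> (\<And>j. j \<in> J' \<Longrightarrow> \<mu> j = \<mu>' j) \<Longrightarrow> measure_sum N J \<mu> = measure_sum N J' \<mu>'"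
  by (simp add: measure_sum_def cong: sum.cong)

lemma measure_sum_image:
  "inj_on f J \<Longrightarrow> measure_sum N (f ` J) \<mu> = measure_sum N J (\<lambda>j. \<mu> (f j))"
  by (simp add: measure_sum_def sum.reindex)

lemma measure_sum_Sigma:
  assumes "finite J" "\<And>j. j \<in> J \<Longrightarrow> finite (K j)"
    and "\<And>j k. j \<in> J \<Longrightarrow> k \<in> K j \<Longrightarrow> sets (\<mu> j k) = sets N"
  shows "measure_sum N J (\<lambda>j. measure_sum N (K j) (\<mu> j)) =
    measure_sum N (Sigma J K) (\<lambda>(j, k). \<mu> j k)"
proof (rule measure_eqI)
  fix A assume "A \<in> sets (measure_sum N J (\<lambda>j. measure_sum N (K j) (\<mu> j)))"
  then have A: "A \<in> sets N" by simp
  have "emeasure (measure_sum N J (\<lambda>j. measure_sum N (K j) (\<mu> j))) A =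
      (\<Sum>j\<in>J. \<Sum>k\<in>K j. emeasure (\<mu> j k) A)"
    using A assms(3) by (simp add: emeasure_measure_sum)
  also have "\<dots> = (\<Sum>(j, k)\<in>Sigma J K. emeasure (\<mu> j k) A)"
    using assms(1,2) by (simp add: sum.Sigma)
  also have "\<dots> = emeasure (measure_sum N (Sigma J K) (\<lambda>(j, k). \<mu> j k)) A"
    using A assms(3) by (subst emeasure_measure_sum) (auto intro!: sum.cong)
  finally show "emeasure (measure_sum N J (\<lambda>j. measure_sum N (K j) (\<mu> j))) A =
      emeasure (measure_sum N (Sigma J K) (\<lambda>(j, k). \<mu> j k)) A" .
qed simp

lemma measure_sum_swap:
  assumes "\<And>j k. j \<in> J \<Longrightarrow> k \<in> K \<Longrightarrow> sets (\<mu> j k) = sets N"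
  shows "measure_sum N J (\<lambda>j. measure_sum N K (\<mu> j)) =
    measure_sum N K (\<lambda>k. measure_sum N J (\<lambda>j. \<mu> j k))"
proof (rule measure_eqI)
  fix A assume "A \<in> sets (measure_sum N J (\<lambda>j. measure_sum N K (\<mu> j)))"
  then show "emeasure (measure_sum N J (\<lambda>j. measure_sum N K (\<mu> j))) A =
      emeasure (measure_sum N K (\<lambda>k. measure_sum N J (\<lambda>j. \<mu> j k))) A"
    using assms sum.swap[of "\<lambda>j k. emeasure (\<mu> j k) A" K J]
    by (simp add: emeasure_measure_sum)
qed simp

text \<open>Push-forward is additive. The formula for creation inserts a coordinate by a
  push-forward, and this lemma carries sums through it.\<close>

lemma distr_measure_sum:
  assumes "f \<in> measurable N N'" "\<And>j. j \<in> J \<Longrightarrow> sets (\<mu> j) = sets N"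
  shows "distr (measure_sum N J \<mu>) N' f = measure_sum N' J (\<lambda>j. distr (\<mu> j) N' f)"
proof (rule measure_eqI)
  fix A assume "A \<in> sets (distr (measure_sum N J \<mu>) N' f)"
  then have A: "A \<in> sets N'" by simp
  have m: "f \<in> measurable (\<mu> j) N'" if "j \<in> J" for j
    using assms(1) measurable_cong_sets[OF assms(2)[OF that] refl, of N'] by simp
  have f: "f \<in> measurable (measure_sum N J \<mu>) N'"
    using assms(1) measurable_cong_sets[of "measure_sum N J \<mu>" N N' N'] by simp
  have "emeasure (distr (measure_sum N J \<mu>) N' f) A =
      (\<Sum>j\<in>J. emeasure (\<mu> j) (f -` A \<inter> space N))"
    using A f assms by (simp add: emeasure_distr emeasure_measure_sum measurable_sets)
  also have "\<dots> = (\<Sum>j\<in>J. emeasure (distr (\<mu> j) N' f) A)"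
    using A m sets_eq_imp_space_eq[OF assms(2)] by (intro sum.cong) (auto simp: emeasure_distr)
  finally show "emeasure (distr (measure_sum N J \<mu>) N' f) A =
      emeasure (measure_sum N' J (\<lambda>j. distr (\<mu> j) N' f)) A"
    using A by (simp add: emeasure_measure_sum)
qed simp

section \<open>Finite sums of vectors\<close>

lemma vars_mvec_on [simp]: "vars (mvec_on \<pi> \<rho> F) = \<pi>"
  and params_mvec_on [simp]: "params (mvec_on \<pi> \<rho> F) = \<rho>"
  and val_mvec_on: "val (mvec_on \<pi> \<rho> F) \<upsilon> x =
    (if finite \<upsilon> \<and> \<upsilon> \<inter> (\<pi> \<union> \<rho>) = {} then F \<upsilon> x else undefined)"
  by (simp_all add: mvec_on_def)

lemma vars_mvec_sum [simp]: "vars (mvec_sum \<pi> \<rho> J \<Psi>) = \<pi>"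
  and params_mvec_sum [simp]: "params (mvec_sum \<pi> \<rho> J \<Psi>) = \<rho>"
  by (simp_all add: mvec_sum_def)

lemma mvec_on_cong:
  assumes "\<And>\<upsilon> x. finite \<upsilon> \<Longrightarrow> \<upsilon> \<inter> (\<pi> \<union> \<rho>) = {} \<Longrightarrow> F \<upsilon> x = G \<upsilon> x"
  shows "mvec_on \<pi> \<rho> F = mvec_on \<pi> \<rho> G"
  unfolding mvec_on_def using assms by (auto simp: fun_eq_iff)

lemma mvec_sum_cong:
  assumes "J = J'" "\<And>j. j \<in> J' \<Longrightarrow> \<Psi> j = \<Psi>' j"
  shows "mvec_sum \<pi> \<rho> J \<Psi> = mvec_sum \<pi> \<rho> J' \<Psi>'"
  unfolding mvec_sum_def using assms by (intro mvec_on_cong measure_sum_cong) auto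

lemma mvec_sum_image:
  "inj_on f J \<Longrightarrow> mvec_sum \<pi> \<rho> (f ` J) \<Psi> = mvec_sum \<pi> \<rho> J (\<lambda>j. \<Psi> (f j))"
  by (simp add: mvec_sum_def measure_sum_image)

text \<open>The side condition for regrouping sums of vectors: all summands share the sigma-algebra
  of the variables \<open>\<pi>\<close>, at those \<open>\<upsilon>\<close> where the value is not
  \<open>undefined\<close>.\<close>

definition measures_on :: "'i set \<Rightarrow> 'i set \<Rightarrow> ('i, 'x::topological_space) mvec \<Rightarrow> bool" where
  "measures_on \<pi> \<rho> \<Psi> \<longleftrightarrow>
     (\<forall>\<upsilon> x. finite \<upsilon> \<longrightarrow> \<upsilon> \<inter> (\<pi> \<union> \<rho>) = {} \<longrightarrow> sets (val \<Psi> \<upsilon> x) = sets (\<Pi>\<^sub>M c\<in>\<pi>. borel))"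

lemma measures_on_mvec_sum [simp]: "measures_on \<pi> \<rho> (mvec_sum \<pi> \<rho> J \<Psi>)"
  by (simp add: measures_on_def mvec_sum_def val_mvec_on)

lemma mvec_sum_Sigma:
  assumes "finite J" "\<And>j. j \<in> J \<Longrightarrow> finite (K j)"
    and "\<And>j k. j \<in> J \<Longrightarrow> k \<in> K j \<Longrightarrow> measures_on \<pi> \<rho> (\<Psi> j k)"
  shows "mvec_sum \<pi> \<rho> J (\<lambda>j. mvec_sum \<pi> \<rho> (K j) (\<Psi> j)) =
    mvec_sum \<pi> \<rho> (Sigma J K) (\<lambda>(j, k). \<Psi> j k)"
  unfolding mvec_sum_def
proof (rule mvec_on_cong)
  fix \<upsilon> x assume \<upsilon>: "finite \<upsilon>" "\<upsilon> \<inter> (\<pi> \<union> \<rho>) = {}"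
  let ?N = "\<Pi>\<^sub>M c\<in>\<pi>. borel"
  have "measure_sum ?N J (\<lambda>j. measure_sum ?N (K j) (\<lambda>k. val (\<Psi> j k) \<upsilon> x)) =
      measure_sum ?N (Sigma J K) (\<lambda>(j, k). val (\<Psi> j k) \<upsilon> x)"
    using assms \<upsilon> by (intro measure_sum_Sigma) (auto simp: measures_on_def)
  then show "measure_sum ?N J (\<lambda>j. val (mvec_on \<pi> \<rho>
        (\<lambda>\<upsilon> x. measure_sum ?N (K j) (\<lambda>k. val (\<Psi> j k) \<upsilon> x))) \<upsilon> x) =
      measure_sum ?N (Sigma J K) (\<lambda>p. val (case p of (j, k) \<Rightarrow> \<Psi> j k) \<upsilon> x)"
    using \<upsilon> by (simp add: val_mvec_on case_prod_unfold)
qed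

text \<open>Stated for vectors of the form \<open>mvec_on\<close> because a sum is
  \<open>undefined\<close> outside its proper domain and could not reproduce other values
  there.\<close>

lemma mvec_sum_singleton:
  assumes "measures_on \<pi> \<rho> (mvec_on \<pi> \<rho> F)"
  shows "mvec_sum \<pi> \<rho> {j} (\<lambda>_. mvec_on \<pi> \<rho> F) = mvec_on \<pi> \<rho> F"
  unfolding mvec_sum_def
proof (rule mvec_on_cong)
  fix \<upsilon> x assume \<upsilon>: "finite \<upsilon>" "\<upsilon> \<inter> (\<pi> \<union> \<rho>) = {}"
  then have "sets (F \<upsilon> x) = sets (\<Pi>\<^sub>M c\<in>\<pi>. borel)"
    using assms by (simp add: measures_on_def val_mvec_on)
  then show "measure_sum (\<Pi>\<^sub>M c\<in>\<pi>. borel) {j} (\<lambda>_. val (mvec_on \<pi> \<rho> F) \<upsilon> x) = F \<upsilon> x"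
    using \<upsilon> by (intro measure_eqI) (auto simp: val_mvec_on emeasure_measure_sum)
qed

section \<open>Bijections\<close>

lemma bijections_iff: "h \<in> bijections A B \<longleftrightarrow> h \<in> extensional A \<and> bij_betw h A B"
  by (auto simp: bijections_def PiE_def bij_betw_def)

lemma finite_bijections: "finite A \<Longrightarrow> finite B \<Longrightarrow> finite (bijections A B)"
  by (rule finite_subset[OF _ finite_PiE[of A "\<lambda>_. B"]]) (auto simp: bijections_def)

lemma fun_upd_bijections:
  assumes "h \<in> bijections A B" "a \<notin> A" "b \<notin> B"
  shows "h(a := b) \<in> bijections (insert a A) (insert b B)"
proof -
  have "bij_betw (h(a := b)) (insert a A) (insert b B)"
    using assms by (auto simp: bijections_iff bij_betw_def inj_on_def)
  then show ?thesis
    using assms by (auto simp: bijections_iff extensional_def)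
qed

lemma restrict_bijections:
  assumes "h \<in> bijections A B" "a \<in> A"
  shows "restrict h (A - {a}) \<in> bijections (A - {a}) (B - {h a})"
    and "h = (restrict h (A - {a}))(a := h a)"
proof -
  have "bij_betw h (A - {a}) (B - {h a})"
    using assms by (auto simp: bijections_iff bij_betw_def inj_on_def)
  then have "bij_betw (restrict h (A - {a})) (A - {a}) (B - {h a})"
    by (subst bij_betw_cong[of _ _ h]) auto
  then show "restrict h (A - {a}) \<in> bijections (A - {a}) (B - {h a})"
    by (simp only: bijections_iff restrict_extensional)
  show "h = (restrict h (A - {a}))(a := h a)"
    using assms by (auto simp: bijections_iff extensional_def restrict_def fun_eq_iff)
qed

lemma fun_upd_extensional_inj:
  assumes "h \<in> extensional A" "h' \<in> extensional A" "a \<notin> A" "h(a := b) = h'(a := b')"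
  shows "h = h'"
proof
  fix x
  show "h x = h' x"
    using fun_cong[OF assms(4), of x] assms(1-3) by (cases "x = a") (auto simp: extensional_def)
qed

text \<open>A bijection on \<open>insert a A\<close> is split by its value \<open>b\<close> at
  \<open>a\<close>. For creation, \<open>a\<close> is the created index.\<close>

lemma bijections_insert_domain:
  assumes "a \<notin> A"
  defines "f \<equiv> \<lambda>(b, h). h(a := b)"
  shows "inj_on f (SIGMA b:B. bijections A (B - {b}))"
    and "f ` (SIGMA b:B. bijections A (B - {b})) = bijections (insert a A) B"
proof -
  show "inj_on f (SIGMA b:B. bijections A (B - {b}))"
  proof (rule inj_onI, clarify)
    fix b h b' h'
    assume h: "h \<in> bijections A (B - {b})" "h' \<in> bijections A (B - {b'})"
      and "f (b, h) = f (b', h')"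
    then have eq: "h(a := b) = h'(a := b')" by (simp add: f_def)
    then have "b = b'" by (metis fun_upd_same)
    moreover have "h = h'"
      using h by (intro fun_upd_extensional_inj[OF _ _ assms(1) eq]) (simp_all add: bijections_iff)
    ultimately show "b = b' \<and> h = h'" ..
  qed
  show "f ` (SIGMA b:B. bijections A (B - {b})) = bijections (insert a A) B"
  proof (intro subset_antisym subsetI)
    fix g assume "g \<in> f ` (SIGMA b:B. bijections A (B - {b}))"
    then obtain b h where "b \<in> B" "h \<in> bijections A (B - {b})" "g = h(a := b)"
      by (auto simp: f_def)
    then show "g \<in> bijections (insert a A) B"
      using fun_upd_bijections[of h A "B - {b}" a b] assms(1) by (simp add: insert_absorb)
  next
    fix g assume g: "g \<in> bijections (insert a A) B"
    have "g a \<in> B" using g by (auto simp: bijections_iff bij_betw_def)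
    moreover have "insert a A - {a} = A" using assms(1) by simp
    ultimately show "g \<in> f ` (SIGMA b:B. bijections A (B - {b}))"
      using restrict_bijections[OF g, of a]
      by (intro image_eqI[of _ _ "(g a, restrict g A)"]) (auto simp: f_def)
  qed
qed

text \<open>A bijection onto \<open>insert b B\<close> is split by the preimage \<open>a\<close> of
  \<open>b\<close>, which can be recognized because \<open>b\<close> is not in \<open>B\<close>. For
  annihilation, \<open>b\<close> is the annihilated index and joins
  \<open>\<upsilon>\<close>.\<close>

lemma bijections_insert_range:
  assumes "b \<notin> B"
  defines "f \<equiv> \<lambda>(a, h). h(a := b)"
  shows "inj_on f (SIGMA a:A. bijections (A - {a}) B)"
    and "f ` (SIGMA a:A. bijections (A - {a}) B) = bijections A (insert b B)"
proof -
  show "inj_on f (SIGMA a:A. bijections (A - {a}) B)"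
  proof (rule inj_onI, clarify)
    fix a h a' h'
    assume a: "a \<in> A" "a' \<in> A" and h: "h \<in> bijections (A - {a}) B" "h' \<in> bijections (A - {a'}) B"
      and eq: "f (a, h) = f (a', h')"
    have "a = a'"
    proof (rule ccontr)
      assume "a \<noteq> a'"
      then have "h' a = b" using fun_cong[OF eq, of a] by (simp add: f_def)
      moreover have "h' a \<in> B" using h(2) a \<open>a \<noteq> a'\<close> by (auto simp: bijections_iff bij_betw_def)
      ultimately show False using assms(1) by simp
    qed
    then show "a = a' \<and> h = h'"
      using fun_upd_extensional_inj[of h "A - {a}" h' a b b] h eq by (simp add: f_def bijections_iff)
  qed
  show "f ` (SIGMA a:A. bijections (A - {a}) B) = bijections A (insert b B)"
  proof (intro subset_antisym subsetI)
    fix g assume "g \<in> f ` (SIGMA a:A. bijections (A - {a}) B)"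
    then obtain a h where "a \<in> A" "h \<in> bijections (A - {a}) B" "g = h(a := b)"
      by (auto simp: f_def)
    then show "g \<in> bijections A (insert b B)"
      using fun_upd_bijections[of h "A - {a}" B a b] assms(1) by (simp add: insert_absorb)
  next
    fix g assume g: "g \<in> bijections A (insert b B)"
    then have "b \<in> g ` A" by (simp add: bijections_iff bij_betw_def)
    then obtain a where a: "a \<in> A" "g a = b" by blast
    then show "g \<in> f ` (SIGMA a:A. bijections (A - {a}) B)"
      using restrict_bijections[OF g, of a] assms(1)
      by (intro image_eqI[of _ _ "(a, restrict g (A - {a}))"]) (auto simp: f_def)
  qed
qed

section \<open>Creation and annihilation\<close>

text \<open>No edge of the union ends in \<open>Domain G\<close>. A path that starts at a target
  therefore uses edges of \<open>S\<close> only, and every point of a circuit is a target.\<close>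

lemma acyclic_Un_sources:
  assumes "acyclic S" "Domain G \<inter> Range (G \<union> S) = {}"
  shows "acyclic (G \<union> S)"
proof -
  have "(a, b) \<in> S\<^sup>+" if "(a, b) \<in> (G \<union> S)\<^sup>+" "a \<in> Range (G \<union> S)" for a b
    using that
  proof (induction rule: trancl_induct)
    case (step y z)
    have "(y, z) \<in> S"
      using step.hyps assms(2) by (meson DomainI UnE disjoint_iff RangeI tranclD2)
    then show ?case using step by (meson trancl.trancl_into_trancl)
  qed (use assms(2) in blast)
  moreover have "a \<in> Range (G \<union> S)" if "(a, a) \<in> (G \<union> S)\<^sup>+" for a
    using that by (meson RangeI tranclD2)
  ultimately show ?thesis using assms(1) unfolding acyclic_def by blast
qed

text \<open>The edges \<open>(h b, b)\<close> issue from \<open>\<upsilon>\<close>, which avoids all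
  variables and hence all targets, so they close no circuit. The conclusions feed
  \<open>E_eq_return\<close> and \<open>root_value_insert\<close>.\<close>

lemma PhiE_term_Un_graph:
  assumes "PhiE_term \<pi> \<rho> \<sigma> S" "h \<in> bijections \<sigma> \<upsilon>" "\<upsilon> \<inter> (\<pi> \<union> \<rho>) = {}"
  defines "G \<equiv> (\<lambda>b. (h b, b)) ` \<sigma> \<union> S"
  shows "finite G" "wf G" "inj_on snd G" "Range G = \<pi>"
proof -
  have S: "finite \<sigma>" "pair_set S" "acyclic S" "\<sigma> \<inter> Range S = {}" "\<pi> = Range S \<union> \<sigma>"
    using assms(1) by (auto simp: PhiE_term_def)
  have h: "h ` \<sigma> = \<upsilon>" using assms(2) by (auto simp: bijections_iff bij_betw_def)
  show fin: "finite G" using S(1,2) by (simp add: G_def pair_set_def)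
  show "Range G = \<pi>" using S(5) by (auto simp: G_def)
  then have "acyclic G"
    unfolding G_def using S(3) assms(3) h by (intro acyclic_Un_sources) auto
  with fin show "wf G" by (rule finite_acyclic_wf)
  have "inj_on snd S" using S(2) by (simp add: pair_set_def)
  then show "inj_on snd G"
    using S(4) by (fastforce simp: G_def inj_on_def)
qed

lemma val_PhiE:
  assumes "PhiE_term \<pi> \<rho> \<sigma> S" "finite \<upsilon>" "\<upsilon> \<inter> (\<pi> \<union> \<rho>) = {}"
  shows "val (PhiE \<sigma> S) \<upsilon> x = measure_sum (\<Pi>\<^sub>M c\<in>\<pi>. borel) (bijections \<sigma> \<upsilon>)
    (\<lambda>h. E ((\<lambda>b. (h b, b)) ` \<sigma> \<union> S) x)"
  using assms by (auto simp: PhiE_def Let_def val_mvec_on PhiE_term_def)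

lemma measures_on_PhiE: "PhiE_term \<pi> \<rho> \<sigma> S \<Longrightarrow> measures_on \<pi> \<rho> (PhiE \<sigma> S)"
  by (auto simp: measures_on_def val_PhiE)

lemma sets_E_term:
  fixes x :: "'i \<Rightarrow> 'x::t1_space"
  assumes "PhiE_term \<pi> \<rho> \<sigma> S" "h \<in> bijections \<sigma> \<upsilon>" "\<upsilon> \<inter> (\<pi> \<union> \<rho>) = {}"
  shows "sets (E ((\<lambda>b. (h b, b)) ` \<sigma> \<union> S) x) = sets (\<Pi>\<^sub>M c\<in>\<pi>. borel)"
  using PhiE_term_Un_graph[OF assms] by (simp add: E_eq_return)

lemma PhiE_term_insert:
  assumes "PhiE_term \<pi> \<rho> \<sigma> S" "c \<notin> \<pi>"
  shows "PhiE_term (\<pi> \<union> {c}) (\<rho> - {c}) (\<sigma> \<union> {c}) S"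
  using assms by (auto simp: PhiE_term_def)

text \<open>The edge \<open>(c, b)\<close> closes no circuit because \<open>c\<close> is not a
  target of \<open>S\<close> and so cannot be reached from \<open>b\<close>. The variables stay the
  same: \<open>b\<close> moves from \<open>\<sigma>\<close> to the range of the relation.\<close>

lemma PhiE_term_contract:
  assumes "PhiE_term \<pi> \<rho> \<sigma> S" "c \<notin> \<pi> \<union> \<rho>" "b \<in> \<sigma>"
  shows "PhiE_term \<pi> (\<rho> \<union> {c}) (\<sigma> - {b}) (S \<union> {(c, b)})"
proof -
  have S: "pair_set S" "acyclic S" "c \<notin> Domain S" "c \<notin> Range S" "c \<noteq> b" "b \<notin> Range S"
    using assms by (auto simp: PhiE_term_def)
  have "pair_set (S \<union> {(c, b)})"
    using S by (fastforce simp: pair_set_def inj_on_def)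
  moreover have "(b, c) \<notin> S\<^sup>*"
    using S(4,5) by (auto elim: rtranclE)
  then have "acyclic (S \<union> {(c, b)})" using S(2) by simp
  ultimately show ?thesis using assms by (auto simp: PhiE_term_def)
qed

text \<open>Bijections from \<open>\<sigma>\<close> onto \<open>insert c \<upsilon>\<close> are
  grouped by the index \<open>b\<close> that is sent to \<open>c\<close>. The factor of that
  \<open>b\<close> is the contraction of \<open>c\<close> with \<open>b\<close>.\<close>

lemma val_annihilation_term:
  fixes x :: "'i \<Rightarrow> 'x::t1_space"
  assumes t: "PhiE_term \<pi> \<rho> \<sigma> S" and "c \<notin> \<pi> \<union> \<rho>"
    and \<upsilon>: "finite \<upsilon>" "\<upsilon> \<inter> (\<pi> \<union> (\<rho> \<union> {c})) = {}"
  shows "val (mvec_sum \<pi> (\<rho> \<union> {c}) \<sigma> (\<lambda>b. PhiE (\<sigma> - {b}) (S \<union> {(c, b)}))) \<upsilon> x =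
    val (PhiE \<sigma> S) (insert c \<upsilon>) x"
proof -
  let ?N = "\<Pi>\<^sub>M c\<in>\<pi>. (borel :: 'x measure)"
  let ?G = "\<lambda>\<sigma> h S. (\<lambda>b. (h b, b)) ` \<sigma> \<union> S"
  let ?I = "SIGMA b:\<sigma>. bijections (\<sigma> - {b}) \<upsilon>"
  have fin: "finite \<sigma>" using t by (simp add: PhiE_term_def)
  note t' = PhiE_term_contract[OF t assms(2)]
  have "val (mvec_sum \<pi> (\<rho> \<union> {c}) \<sigma> (\<lambda>b. PhiE (\<sigma> - {b}) (S \<union> {(c, b)}))) \<upsilon> x =
      measure_sum ?N \<sigma> (\<lambda>b. val (PhiE (\<sigma> - {b}) (S \<union> {(c, b)})) \<upsilon> x)"
    using \<upsilon> by (simp add: mvec_sum_def val_mvec_on)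
  also have "\<dots> = measure_sum ?N \<sigma> (\<lambda>b. measure_sum ?N (bijections (\<sigma> - {b}) \<upsilon>)
        (\<lambda>h. E (?G (\<sigma> - {b}) h (S \<union> {(c, b)})) x))"
    by (rule measure_sum_cong[OF refl val_PhiE[OF t' \<upsilon>]])
  also have "\<dots> = measure_sum ?N ?I (\<lambda>(b, h). E (?G (\<sigma> - {b}) h (S \<union> {(c, b)})) x)"
    using fin \<upsilon>(1)
    by (intro measure_sum_Sigma sets_E_term[OF t' _ \<upsilon>(2)]) (auto simp: finite_bijections)
  also have "\<dots> = measure_sum ?N ?I (\<lambda>j. E (?G \<sigma> ((\<lambda>(b, h). h(b := c)) j) S) x)"
  proof (rule measure_sum_cong[OF refl], clarify)
    fix b h assume "b \<in> \<sigma>"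
    \<comment> \<open>Both sides are the same relation; only the bookkeeping of the edge
      \<open>(c, b)\<close> differs, once as part of \<open>S\<close> and once as part of the graph
      of \<open>h\<close>.\<close>
    then have "?G (\<sigma> - {b}) h (S \<union> {(c, b)}) = ?G \<sigma> (h(b := c)) S" by auto
    then show "E (?G (\<sigma> - {b}) h (S \<union> {(c, b)})) x = E (?G \<sigma> (h(b := c)) S) x" by simp
  qed
  also have "\<dots> = measure_sum ?N (bijections \<sigma> (insert c \<upsilon>)) (\<lambda>h. E (?G \<sigma> h S) x)"
    using bijections_insert_range[of c \<upsilon> \<sigma>] \<upsilon>
    by (subst measure_sum_image[symmetric, where \<mu> = "\<lambda>h. E (?G \<sigma> h S) x"]) auto
  also have "\<dots> = val (PhiE \<sigma> S) (insert c \<upsilon>) x"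
    using \<upsilon> assms(2) by (intro val_PhiE[OF t, symmetric]) auto
  finally show ?thesis .
qed

text \<open>The right-hand side mentions \<open>\<Psi>\<close> but no representation of it, so the
  definite description in \<open>annihilation\<close> is justified.\<close>

lemma annihilation_image_unique:
  fixes \<Psi> :: "('i, 'x::t1_space) mvec"
  assumes "annihilation_image c \<Psi> \<Psi>'"
  shows "\<Psi>' = mvec_on (vars \<Psi>) (params \<Psi> \<union> {c}) (\<lambda>\<upsilon> x. val \<Psi> (insert c \<upsilon>) x)"
proof -
  obtain \<pi> \<rho> \<sigma> S and m :: nat where c: "c \<notin> \<pi> \<union> \<rho>"
    and t: "\<And>j. j < m \<Longrightarrow> PhiE_term \<pi> \<rho> (\<sigma> j) (S j)"
    and \<Psi>: "\<Psi> = mvec_sum \<pi> \<rho> {..<m} (\<lambda>j. PhiE (\<sigma> j) (S j))"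
    and \<Psi>': "\<Psi>' = mvec_sum \<pi> (\<rho> \<union> {c}) {..<m} (\<lambda>j.
      mvec_sum \<pi> (\<rho> \<union> {c}) (\<sigma> j) (\<lambda>b. PhiE (\<sigma> j - {b}) (S j \<union> {(c, b)})))"
    using assms unfolding annihilation_image_def by blast
  show ?thesis
    unfolding \<Psi>' \<Psi> vars_mvec_sum params_mvec_sum
    unfolding mvec_sum_def[of \<pi> "\<rho> \<union> {c}" "{..<m}"]
  proof (rule mvec_on_cong)
    fix \<upsilon> and x :: "'i \<Rightarrow> 'x" assume \<upsilon>: "finite \<upsilon>" "\<upsilon> \<inter> (\<pi> \<union> (\<rho> \<union> {c})) = {}"
    \<comment> \<open>\<open>c \<notin> \<pi> \<union> \<rho>\<close> keeps
      \<open>insert c \<upsilon>\<close> in the proper domain, where the value is not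
      \<open>undefined\<close>.\<close>
    then have "val (mvec_sum \<pi> \<rho> {..<m} (\<lambda>j. PhiE (\<sigma> j) (S j))) (insert c \<upsilon>) x =
        measure_sum (\<Pi>\<^sub>M c\<in>\<pi>. borel) {..<m} (\<lambda>j. val (PhiE (\<sigma> j) (S j)) (insert c \<upsilon>) x)"
      using c by (simp add: mvec_sum_def val_mvec_on)
    then show "measure_sum (\<Pi>\<^sub>M c\<in>\<pi>. borel) {..<m} (\<lambda>j. val (mvec_sum \<pi> (\<rho> \<union> {c}) (\<sigma> j)
          (\<lambda>b. PhiE (\<sigma> j - {b}) (S j \<union> {(c, b)}))) \<upsilon> x) =
        val (mvec_sum \<pi> \<rho> {..<m} (\<lambda>j. PhiE (\<sigma> j) (S j))) (insert c \<upsilon>) x"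
      using val_annihilation_term[OF t c \<upsilon>] by (auto intro: measure_sum_cong)
  qed
qed

text \<open>Bijections from \<open>\<sigma> \<union> {c}\<close> are grouped by the image
  \<open>b\<close> of \<open>c\<close>. The edge \<open>(b, c)\<close> moves the root of a chain
  starting at \<open>c\<close> to \<open>b\<close>, hence the changed parameter, and adds the
  coordinate \<open>x_c = x_b\<close>, hence the push-forward.\<close>

lemma val_creation_term:
  fixes x :: "'i \<Rightarrow> 'x::t1_space"
  assumes t: "PhiE_term \<pi> \<rho> \<sigma> S" and "c \<notin> \<pi>"
    and \<upsilon>: "finite \<upsilon>" "\<upsilon> \<inter> (\<pi> \<union> {c} \<union> (\<rho> - {c})) = {}"
  shows "val (PhiE (\<sigma> \<union> {c}) S) \<upsilon> x =
    measure_sum (\<Pi>\<^sub>M c\<in>\<pi> \<union> {c}. borel) \<upsilon> (\<lambda>b.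
      distr (val (PhiE \<sigma> S) (\<upsilon> - {b}) (x(c := x b))) (\<Pi>\<^sub>M c\<in>\<pi> \<union> {c}. borel) (\<lambda>w. w(c := x b)))"
proof -
  let ?N = "\<Pi>\<^sub>M c\<in>\<pi>. (borel :: 'x measure)" and ?N' = "\<Pi>\<^sub>M c\<in>\<pi> \<union> {c}. (borel :: 'x measure)"
  let ?G = "\<lambda>\<sigma> h. (\<lambda>b. (h b, b)) ` \<sigma> \<union> S"
  let ?I = "SIGMA b:\<upsilon>. bijections \<sigma> (\<upsilon> - {b})"
  have fin: "finite \<sigma>" and c: "c \<notin> \<sigma>" using t assms(2) by (auto simp: PhiE_term_def)
  note t' = PhiE_term_insert[OF t assms(2)]
  \<comment> \<open>This includes the case that \<open>c\<close> is a parameter of the old vector: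
    \<open>\<upsilon>\<close> avoids \<open>c\<close> as a variable of the new one.\<close>
  have \<upsilon>': "(\<upsilon> - {b}) \<inter> (\<pi> \<union> \<rho>) = {}" for b using \<upsilon>(2) by auto
  have upd: "(\<lambda>w. w(c := x b)) \<in> measurable ?N ?N'" for b
    by (rule measurable_fun_upd[where J = \<pi>]) auto
  have E_upd: "E (?G (\<sigma> \<union> {c}) (h(c := b))) x =
      distr (E (?G \<sigma> h) (x(c := x b))) ?N' (\<lambda>w. w(c := x b))"
    if b: "b \<in> \<upsilon>" and h: "h \<in> bijections \<sigma> (\<upsilon> - {b})" for b h
  proof -
    let ?H = "?G \<sigma> h"
    note H = PhiE_term_Un_graph[OF t h \<upsilon>']
    have "h(c := b) \<in> bijections (\<sigma> \<union> {c}) \<upsilon>"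
      using fun_upd_bijections[OF h, of c b] c b by (simp add: insert_absorb)
    note H' = PhiE_term_Un_graph[OF t' this \<upsilon>(2)]
    have eq: "?G (\<sigma> \<union> {c}) (h(c := b)) = insert (b, c) ?H"
      using c by auto
    have bc: "c \<notin> Range ?H" "b \<notin> Range ?H" "b \<noteq> c"
      using assms(2) \<upsilon>(2) b unfolding H(4) by auto
    have root: "root_value (insert (b, c) ?H) x e = root_value ?H (x(c := x b)) e" for e
      using H H' bc unfolding eq by (intro root_value_insert) auto
    have "E (insert (b, c) ?H) x = return ?N' (restrict (root_value ?H (x(c := x b))) (\<pi> \<union> {c}))"
      using H'(1,4) unfolding eq by (simp add: E_eq_return root cong: restrict_cong)
    \<comment> \<open>\<open>c\<close> is no target of the old graph, so its root value is the
      changed parameter value \<open>x b\<close>; this is the inserted coordinate.\<close>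
    also have "restrict (root_value ?H (x(c := x b))) (\<pi> \<union> {c}) =
        (restrict (root_value ?H (x(c := x b))) \<pi>)(c := x b)"
      using bc(1) assms(2) by (auto simp: restrict_def root_value_root)
    also have "return ?N' \<dots> =
        distr (return ?N (restrict (root_value ?H (x(c := x b))) \<pi>)) ?N' (\<lambda>w. w(c := x b))"
      using upd by (subst distr_return) (auto simp: space_PiM)
    also have "return ?N (restrict (root_value ?H (x(c := x b))) \<pi>) = E ?H (x(c := x b))"
      using H(1,4) by (simp add: E_eq_return)
    finally show ?thesis unfolding eq .
  qed
  have "val (PhiE (\<sigma> \<union> {c}) S) \<upsilon> x =
      measure_sum ?N' (bijections (\<sigma> \<union> {c}) \<upsilon>) (\<lambda>h. E (?G (\<sigma> \<union> {c}) h) x)"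
    by (rule val_PhiE[OF t' \<upsilon>])
  also have "\<dots> = measure_sum ?N' ?I (\<lambda>j. E (?G (\<sigma> \<union> {c}) ((\<lambda>(b, h). h(c := b)) j)) x)"
    using bijections_insert_domain[OF c, of \<upsilon>]
    by (subst measure_sum_image[symmetric, where \<mu> = "\<lambda>h. E (?G (\<sigma> \<union> {c}) h) x"]) auto
  also have "\<dots> = measure_sum ?N' ?I (\<lambda>(b, h).
      distr (E (?G \<sigma> h) (x(c := x b))) ?N' (\<lambda>w. w(c := x b)))"
    by (intro measure_sum_cong refl) (clarsimp simp only: E_upd mem_Sigma_iff prod.case)
  also have "\<dots> = measure_sum ?N' \<upsilon> (\<lambda>b. measure_sum ?N' (bijections \<sigma> (\<upsilon> - {b})) (\<lambda>h.
      distr (E (?G \<sigma> h) (x(c := x b))) ?N' (\<lambda>w. w(c := x b))))"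
    using fin \<upsilon> by (intro measure_sum_Sigma[symmetric]) (auto simp: finite_bijections)
  also have "\<dots> = measure_sum ?N' \<upsilon> (\<lambda>b.
      distr (val (PhiE \<sigma> S) (\<upsilon> - {b}) (x(c := x b))) ?N' (\<lambda>w. w(c := x b)))"
  proof (rule measure_sum_cong[OF refl])
    fix b
    show "measure_sum ?N' (bijections \<sigma> (\<upsilon> - {b})) (\<lambda>h.
        distr (E (?G \<sigma> h) (x(c := x b))) ?N' (\<lambda>w. w(c := x b))) =
      distr (val (PhiE \<sigma> S) (\<upsilon> - {b}) (x(c := x b))) ?N' (\<lambda>w. w(c := x b))"
      using \<upsilon>(1) by (subst val_PhiE[OF t _ \<upsilon>'])
        (auto intro!: distr_measure_sum[symmetric] upd sets_E_term[OF t _ \<upsilon>'])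
  qed
  finally show ?thesis .
qed

text \<open>As for annihilation, the formula depends on \<open>\<Psi>\<close> alone. The sums over
  the representation and over \<open>b\<close> are interchanged, and additivity of push-forward
  reassembles the value of \<open>\<Psi>\<close>.\<close>

lemma creation_image_unique:
  fixes \<Psi> :: "('i, 'x::t1_space) mvec"
  assumes "creation_image c \<Psi> \<Psi>'"
  shows "\<Psi>' = mvec_on (vars \<Psi> \<union> {c}) (params \<Psi> - {c}) (\<lambda>\<upsilon> x.
    measure_sum (\<Pi>\<^sub>M c\<in>vars \<Psi> \<union> {c}. borel) \<upsilon> (\<lambda>b.
      distr (val \<Psi> (\<upsilon> - {b}) (x(c := x b))) (\<Pi>\<^sub>M c\<in>vars \<Psi> \<union> {c}. borel) (\<lambda>w. w(c := x b))))"
proof -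
  obtain \<pi> \<rho> \<sigma> S and m :: nat where c: "c \<notin> \<pi>"
    and t: "\<And>j. j < m \<Longrightarrow> PhiE_term \<pi> \<rho> (\<sigma> j) (S j)"
    and \<Psi>: "\<Psi> = mvec_sum \<pi> \<rho> {..<m} (\<lambda>j. PhiE (\<sigma> j) (S j))"
    and \<Psi>': "\<Psi>' = mvec_sum (\<pi> \<union> {c}) (\<rho> - {c}) {..<m} (\<lambda>j. PhiE (\<sigma> j \<union> {c}) (S j))"
    using assms unfolding creation_image_def by blast
  let ?N' = "\<Pi>\<^sub>M c\<in>\<pi> \<union> {c}. (borel :: 'x measure)"
  show ?thesis
    unfolding \<Psi>' \<Psi> vars_mvec_sum params_mvec_sum
    unfolding mvec_sum_def[of "\<pi> \<union> {c}"]
  proof (rule mvec_on_cong)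
    fix \<upsilon> and x :: "'i \<Rightarrow> 'x"
    assume \<upsilon>: "finite \<upsilon>" "\<upsilon> \<inter> (\<pi> \<union> {c} \<union> (\<rho> - {c})) = {}"
    let ?V = "\<lambda>j b. val (PhiE (\<sigma> j) (S j)) (\<upsilon> - {b}) (x(c := x b))"
    have \<upsilon>': "finite (\<upsilon> - {b})" "(\<upsilon> - {b}) \<inter> (\<pi> \<union> \<rho>) = {}" for b
      using \<upsilon> by auto
    have "measure_sum ?N' {..<m} (\<lambda>j. val (PhiE (\<sigma> j \<union> {c}) (S j)) \<upsilon> x) =
        measure_sum ?N' {..<m} (\<lambda>j. measure_sum ?N' \<upsilon> (\<lambda>b.
          distr (?V j b) ?N' (\<lambda>w. w(c := x b))))"
      by (intro measure_sum_cong refl val_creation_term[OF t c \<upsilon>]) simp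
    also have "\<dots> = measure_sum ?N' \<upsilon> (\<lambda>b. measure_sum ?N' {..<m} (\<lambda>j.
          distr (?V j b) ?N' (\<lambda>w. w(c := x b))))"
      by (rule measure_sum_swap) simp
    also have "\<dots> = measure_sum ?N' \<upsilon> (\<lambda>b. distr
        (val (mvec_sum \<pi> \<rho> {..<m} (\<lambda>j. PhiE (\<sigma> j) (S j))) (\<upsilon> - {b}) (x(c := x b)))
        ?N' (\<lambda>w. w(c := x b)))"
    proof (rule measure_sum_cong[OF refl])
      fix b
      have sets: "sets (?V j b) = sets (\<Pi>\<^sub>M c\<in>\<pi>. borel)" if "j \<in> {..<m}" for j
        by (rule measures_on_PhiE[OF t, unfolded measures_on_def, rule_format])
          (use that \<upsilon>' in \<open>simp_all only: lessThan_iff\<close>)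
      have upd: "(\<lambda>w. w(c := x b)) \<in> measurable (\<Pi>\<^sub>M c\<in>\<pi>. borel) ?N'"
        by (rule measurable_fun_upd[where J = \<pi>]) auto
      have "val (mvec_sum \<pi> \<rho> {..<m} (\<lambda>j. PhiE (\<sigma> j) (S j))) (\<upsilon> - {b}) (x(c := x b)) =
          measure_sum (\<Pi>\<^sub>M c\<in>\<pi>. borel) {..<m} (\<lambda>j. ?V j b)"
        unfolding mvec_sum_def val_mvec_on by (rule if_P) (use \<upsilon>' in blast)
      then show "measure_sum ?N' {..<m} (\<lambda>j. distr (?V j b) ?N' (\<lambda>w. w(c := x b))) = distr
          (val (mvec_sum \<pi> \<rho> {..<m} (\<lambda>j. PhiE (\<sigma> j) (S j))) (\<upsilon> - {b}) (x(c := x b)))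
          ?N' (\<lambda>w. w(c := x b))"
        using distr_measure_sum[OF upd, of "{..<m}" "\<lambda>j. ?V j b", OF sets] by (simp only:)
    qed
    finally show "measure_sum ?N' {..<m} (\<lambda>j. val (PhiE (\<sigma> j \<union> {c}) (S j)) \<upsilon> x) =
        measure_sum ?N' \<upsilon> (\<lambda>b. distr
          (val (mvec_sum \<pi> \<rho> {..<m} (\<lambda>j. PhiE (\<sigma> j) (S j))) (\<upsilon> - {b}) (x(c := x b)))
          ?N' (\<lambda>w. w(c := x b)))" .
  qed
qed

section \<open>The operators on sums over arbitrary finite index sets\<close>

lemma creation_eq:
  fixes \<Psi> :: "('i, 'x::t1_space) mvec"
  assumes "creation_image c \<Psi> \<Psi>'"
  shows "creation c \<Psi> = \<Psi>'"
  unfolding creation_def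
proof (rule the_equality, rule assms)
  fix \<Psi>'' assume "creation_image c \<Psi> \<Psi>''"
  then show "\<Psi>'' = \<Psi>'"
    by (rule trans[OF creation_image_unique creation_image_unique[OF assms, symmetric]])
qed

lemma annihilation_eq:
  fixes \<Psi> :: "('i, 'x::t1_space) mvec"
  assumes "annihilation_image c \<Psi> \<Psi>'"
  shows "annihilation c \<Psi> = \<Psi>'"
  unfolding annihilation_def
proof (rule the_equality, rule assms)
  fix \<Psi>'' assume "annihilation_image c \<Psi> \<Psi>''"
  then show "\<Psi>'' = \<Psi>'"
    by (rule trans[OF annihilation_image_unique annihilation_image_unique[OF assms, symmetric]])
qed

lemma mvec_sum_bij:
  "bij_betw f J K \<Longrightarrow> mvec_sum \<pi> \<rho> K \<Psi> = mvec_sum \<pi> \<rho> J (\<lambda>j. \<Psi> (f j))"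
  by (auto simp: bij_betw_def mvec_sum_image)

lemma ex_bij_betw_lessThan:
  assumes "finite K"
  obtains f and m :: nat where "bij_betw f {..<m} K"
  using ex_bij_betw_nat_finite[OF assms] that by (auto simp: atLeast0LessThan)

text \<open>\<open>creation_image\<close> speaks of sums over \<open>{..<m}\<close>; an enumeration
  of \<open>K\<close> transports the argument and the result to that form.\<close>

lemma creation_mvec_sum:
  fixes \<sigma> :: "'k \<Rightarrow> 'i set"
  assumes "finite K" "finite \<pi>" "finite \<rho>" "\<pi> \<inter> \<rho> = {}" "c \<notin> \<pi>"
    and t: "\<And>k. k \<in> K \<Longrightarrow> PhiE_term \<pi> \<rho> (\<sigma> k) (S k)"
  shows "creation c (mvec_sum \<pi> \<rho> K (\<lambda>k. PhiE (\<sigma> k) (S k)) :: ('i, 'x::t1_space) mvec) =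
    mvec_sum (\<pi> \<union> {c}) (\<rho> - {c}) K (\<lambda>k. PhiE (\<sigma> k \<union> {c}) (S k))"
proof (rule creation_eq)
  obtain f and m :: nat where f: "bij_betw f {..<m} K"
    using ex_bij_betw_lessThan[OF assms(1)] .
  show "creation_image c (mvec_sum \<pi> \<rho> K (\<lambda>k. PhiE (\<sigma> k) (S k)) :: ('i, 'x) mvec)
      (mvec_sum (\<pi> \<union> {c}) (\<rho> - {c}) K (\<lambda>k. PhiE (\<sigma> k \<union> {c}) (S k)))"
    unfolding creation_image_def mvec_sum_bij[OF f] using assms(2-5) t f[THEN bij_betwE]
    by (intro exI[of _ \<pi>] exI[of _ \<rho>] exI[of _ m] exI[of _ "\<lambda>j. \<sigma> (f j)"] exI[of _ "\<lambda>j. S (f j)"])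
      simp
qed

text \<open>The iterated sum is flattened into one sum of vectors \<open>PhiE\<close>, the form that
  the next operator takes as its argument.\<close>

lemma annihilation_mvec_sum:
  fixes \<sigma> :: "'k \<Rightarrow> 'i set"
  assumes "finite K" "finite \<pi>" "finite \<rho>" "\<pi> \<inter> \<rho> = {}" "c \<notin> \<pi> \<union> \<rho>"
    and t: "\<And>k. k \<in> K \<Longrightarrow> PhiE_term \<pi> \<rho> (\<sigma> k) (S k)"
  shows "annihilation c (mvec_sum \<pi> \<rho> K (\<lambda>k. PhiE (\<sigma> k) (S k)) :: ('i, 'x::t1_space) mvec) =
    mvec_sum \<pi> (\<rho> \<union> {c}) (Sigma K \<sigma>) (\<lambda>(k, b). PhiE (\<sigma> k - {b}) (S k \<union> {(c, b)}))"
proof -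
  let ?\<Psi> = "mvec_sum \<pi> \<rho> K (\<lambda>k. PhiE (\<sigma> k) (S k)) :: ('i, 'x) mvec"
  let ?\<Psi>' = "mvec_sum \<pi> (\<rho> \<union> {c}) K (\<lambda>k.
    mvec_sum \<pi> (\<rho> \<union> {c}) (\<sigma> k) (\<lambda>b. PhiE (\<sigma> k - {b}) (S k \<union> {(c, b)}))) :: ('i, 'x) mvec"
  obtain f and m :: nat where f: "bij_betw f {..<m} K"
    using ex_bij_betw_lessThan[OF assms(1)] .
  have "annihilation_image c ?\<Psi> ?\<Psi>'"
    unfolding annihilation_image_def mvec_sum_bij[OF f] using assms(2-5) t f[THEN bij_betwE]
    by (intro exI[of _ \<pi>] exI[of _ \<rho>] exI[of _ m] exI[of _ "\<lambda>j. \<sigma> (f j)"] exI[of _ "\<lambda>j. S (f j)"])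
      simp
  then have "annihilation c ?\<Psi> = ?\<Psi>'" by (rule annihilation_eq)
  also have "\<dots> = mvec_sum \<pi> (\<rho> \<union> {c}) (Sigma K \<sigma>)
      (\<lambda>(k, b). PhiE (\<sigma> k - {b}) (S k \<union> {(c, b)}))"
    using assms(1) t by (intro mvec_sum_Sigma measures_on_PhiE PhiE_term_contract[OF t assms(5)])
      (auto simp: PhiE_term_def)
  finally show ?thesis .
qed

section \<open>Complete contractions\<close>

text \<open>Edges join index names, not positions, so that a relation can serve directly as the
  \<open>S\<close> of \<open>PhiE\<close>. Each annihilator index gets one target and targets are
  not shared; \<open>r < q\<close> is asked of partners among the creators only. Absence of circuits
  is derived in \<open>PhiE_term_contractions\<close>.\<close>

definition contractions ::
    "nat \<Rightarrow> (nat \<Rightarrow> int) \<Rightarrow> (nat \<Rightarrow> 'i) \<Rightarrow> 'i set \<Rightarrow> ('i \<times> 'i) set set" where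
  "contractions n \<theta> c \<upsilon> = {S. Domain S = c ` {i \<in> {1..n}. \<theta> i = -1} \<and>
     single_valued S \<and> single_valued (S\<inverse>) \<and>
     (\<forall>(b, e)\<in>S. e \<in> \<upsilon> \<or>
       (\<exists>q\<in>{1..n}. \<exists>r\<in>{1..n}. b = c q \<and> e = c r \<and> \<theta> q = -1 \<and> \<theta> r = 1 \<and> r < q))}"

lemma Range_contractions: "S \<in> contractions n \<theta> c \<upsilon> \<Longrightarrow> Range S \<subseteq> wick_vars n \<theta> c \<upsilon>"
  by (fastforce simp: contractions_def wick_vars_def)

lemma finite_contractions: "finite \<upsilon> \<Longrightarrow> finite (contractions n \<theta> c \<upsilon>)"
proof (rule finite_subset)
  show "contractions n \<theta> c \<upsilon> \<subseteq> Pow (c ` {i \<in> {1..n}. \<theta> i = -1} \<times> wick_vars n \<theta> c \<upsilon>)"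
  proof (intro subsetI PowI)
    fix S p assume S: "S \<in> contractions n \<theta> c \<upsilon>" and p: "p \<in> S"
    then have "fst p \<in> Domain S" "snd p \<in> Range S" by (auto simp: Domain_fst Range_snd)
    then show "p \<in> c ` {i \<in> {1..n}. \<theta> i = -1} \<times> wick_vars n \<theta> c \<upsilon>"
      using Range_contractions[OF S] S by (auto simp: contractions_def mem_Times_iff)
  qed
qed (simp add: wick_vars_def)

lemma atLeastAtMost_Suc_Collect:
  "{i \<in> {1..Suc n}. P i} = {i \<in> {1..n}. P i} \<union> (if P (Suc n) then {Suc n} else {})"
  by (auto simp: le_Suc_eq)

text \<open>A creator can be contracted only with a later annihilator, and nothing comes after
  position \<open>Suc n\<close>.\<close>

lemma contractions_Suc_creation:
  assumes "\<theta> (Suc n) = 1"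
  shows "contractions (Suc n) \<theta> c \<upsilon> = contractions n \<theta> c \<upsilon>"
proof -
  have "(\<exists>q\<in>{1..Suc n}. \<exists>r\<in>{1..Suc n}. b = c q \<and> e = c r \<and> \<theta> q = -1 \<and> \<theta> r = 1 \<and> r < q) \<longleftrightarrow>
    (\<exists>q\<in>{1..n}. \<exists>r\<in>{1..n}. b = c q \<and> e = c r \<and> \<theta> q = -1 \<and> \<theta> r = 1 \<and> r < q)" for b e
    using assms by (auto simp: le_Suc_eq Bex_def)
  then show ?thesis
    using assms by (simp add: contractions_def atLeastAtMost_Suc_Collect del: One_nat_def atLeastAtMost_iff)
qed

text \<open>The last annihilator comes after every creator, so any target not yet taken is allowed.
  Its name is fresh, so its edge can be located in the enlarged relation and removed again.\<close>

lemma contractions_Suc_annihilation: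
  fixes c :: "nat \<Rightarrow> 'i" and \<upsilon> :: "'i set"
  assumes "\<theta> (Suc n) = -1" "c (Suc n) \<notin> c ` {1..n}"
  defines "f \<equiv> \<lambda>(S, b). S \<union> {(c (Suc n), b)}"
  defines "I \<equiv> SIGMA S:contractions n \<theta> c \<upsilon>. wick_vars n \<theta> c \<upsilon> - Range S"
  shows "inj_on f I" and "f ` I = contractions (Suc n) \<theta> c \<upsilon>"
proof -
  let ?c = "c (Suc n)"
  have new: "?c \<notin> Domain S" if "S \<in> contractions n \<theta> c \<upsilon>" for S
    using that assms(2) by (auto simp: contractions_def)
  have Dom: "c ` {i \<in> {1..Suc n}. \<theta> i = -1} = insert ?c (c ` {i \<in> {1..n}. \<theta> i = -1})"
    using assms(1) by (simp add: atLeastAtMost_Suc_Collect del: One_nat_def atLeastAtMost_iff)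
  show "inj_on f I"
  proof (rule inj_onI, clarify)
    fix S b S' b' assume "(S, b) \<in> I" "(S', b') \<in> I" "f (S, b) = f (S', b')"
    then have eq: "S \<union> {(?c, b)} = S' \<union> {(?c, b')}" and "?c \<notin> Domain S" "?c \<notin> Domain S'"
      using new by (auto simp: I_def f_def)
    then have not: "(?c, e) \<notin> S" "(?c, e) \<notin> S'" for e by auto
    then have "b = b'" using eq by blast
    then show "S = S' \<and> b = b'" using eq not by blast
  qed
  show "f ` I = contractions (Suc n) \<theta> c \<upsilon>"
  proof (intro subset_antisym subsetI)
    fix T assume "T \<in> f ` I"
    then obtain S b where S: "S \<in> contractions n \<theta> c \<upsilon>" and b: "b \<in> wick_vars n \<theta> c \<upsilon>" "b \<notin> Range S"
      and T: "T = S \<union> {(?c, b)}" by (auto simp: I_def f_def)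
    have "Domain T = c ` {i \<in> {1..Suc n}. \<theta> i = -1}"
      using S unfolding Dom T by (simp add: contractions_def)
    moreover have "single_valued T" "single_valued (T\<inverse>)"
      using S new[OF S] b(2) unfolding T by (auto simp: contractions_def single_valued_def)
    moreover have "e \<in> \<upsilon> \<or> (\<exists>q\<in>{1..Suc n}. \<exists>r\<in>{1..Suc n}.
        a = c q \<and> e = c r \<and> \<theta> q = -1 \<and> \<theta> r = 1 \<and> r < q)" if "(a, e) \<in> T" for a e
    proof (cases "(a, e) \<in> S")
      case True
      then have "e \<in> \<upsilon> \<or> (\<exists>q\<in>{1..n}. \<exists>r\<in>{1..n}.
          a = c q \<and> e = c r \<and> \<theta> q = -1 \<and> \<theta> r = 1 \<and> r < q)"
        using S by (auto simp: contractions_def)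
      then show ?thesis by (meson atLeastAtMost_iff le_SucI)
    next
      case False
      then have "a = ?c" "e = b" using that T by auto
      moreover have "b \<in> \<upsilon> \<or> (\<exists>r\<in>{1..n}. b = c r \<and> \<theta> r = 1)"
        using b(1) by (auto simp: wick_vars_def)
      ultimately show ?thesis
      proof (elim disjE bexE conjE)
        fix r assume "r \<in> {1..n}" "b = c r" "\<theta> r = 1"
        then show ?thesis
          using assms(1) \<open>a = ?c\<close> \<open>e = b\<close> by (intro disjI2 bexI[of _ "Suc n"] bexI[of _ r]) auto
      qed simp
    qed
    ultimately show "T \<in> contractions (Suc n) \<theta> c \<upsilon>"
      unfolding contractions_def by blast
  next
    fix T assume T: "T \<in> contractions (Suc n) \<theta> c \<upsilon>"
    then have DomT: "Domain T = insert ?c (c ` {i \<in> {1..n}. \<theta> i = -1})"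
      and sv: "single_valued T" "single_valued (T\<inverse>)"
      and alt: "\<And>a e. (a, e) \<in> T \<Longrightarrow> e \<in> \<upsilon> \<or> (\<exists>q\<in>{1..Suc n}. \<exists>r\<in>{1..Suc n}.
        a = c q \<and> e = c r \<and> \<theta> q = -1 \<and> \<theta> r = 1 \<and> r < q)"
      unfolding contractions_def Dom by auto
    obtain b where b: "(?c, b) \<in> T" using DomT by blast
    define S where "S = T - {(?c, b)}"
    have TS: "T = S \<union> {(?c, b)}" using b by (auto simp: S_def)
    \<comment> \<open>Single-valuedness leaves only one edge out of the new annihilator, and it has
      been removed.\<close>
    have not_c: "a \<noteq> ?c" if "(a, e) \<in> S" for a e
      using that b sv(1) by (auto simp: S_def single_valued_def)
    have "Domain S = c ` {i \<in> {1..n}. \<theta> i = -1}"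
    proof -
      have "?c \<notin> Domain S" using not_c by auto
      moreover have "Domain T = insert ?c (Domain S)" using TS by auto
      moreover have "?c \<notin> c ` {i \<in> {1..n}. \<theta> i = -1}" using assms(2) by auto
      ultimately show ?thesis using DomT by (metis insert_ident)
    qed
    moreover have "single_valued S" "single_valued (S\<inverse>)"
      using sv by (auto simp: S_def single_valued_def)
    moreover have "e \<in> \<upsilon> \<or> (\<exists>q\<in>{1..n}. \<exists>r\<in>{1..n}.
        a = c q \<and> e = c r \<and> \<theta> q = -1 \<and> \<theta> r = 1 \<and> r < q)" if "(a, e) \<in> S" for a e
    proof -
      have "(a, e) \<in> T" using that TS by blast
      then consider "e \<in> \<upsilon>" | q r where "q \<in> {1..Suc n}" "r \<in> {1..Suc n}" "a = c q" "e = c r"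
          "\<theta> q = -1" "\<theta> r = 1" "r < q"
        using alt by blast
      then show ?thesis
      proof cases
        case 2
        \<comment> \<open>With \<open>r < q\<close> this brings both positions down into
          \<open>{1..n}\<close>.\<close>
        moreover have "q \<noteq> Suc n" using not_c[OF that] 2(3) by blast
        ultimately show ?thesis
          by (intro disjI2 bexI[of _ q] bexI[of _ r]) auto
      qed simp
    qed
    ultimately have "S \<in> contractions n \<theta> c \<upsilon>"
      unfolding contractions_def by blast
    moreover have "b \<notin> Range S"
      using sv(2) b by (auto simp: S_def single_valued_def)
    moreover have "b \<in> wick_vars n \<theta> c \<upsilon>"
    proof -
      consider "b \<in> \<upsilon>" | q r where "q \<in> {1..Suc n}" "r \<in> {1..Suc n}" "b = c r" "\<theta> r = 1" "r < q"
        using alt[OF b] by blast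
      then show ?thesis by cases (auto simp: wick_vars_def)
    qed
    ultimately show "T \<in> f ` I"
      using TS by (intro image_eqI[of _ _ "(S, b)"]) (auto simp: I_def f_def)
  qed
qed

section \<open>Wick's theorem\<close>

locale wick_sequence =
  fixes n :: nat and \<theta> :: "nat \<Rightarrow> int" and c :: "nat \<Rightarrow> 'i" and \<upsilon> :: "'i set"
  assumes signs: "\<forall>i\<in>{1..n}. \<theta> i = 1 \<or> \<theta> i = -1"
    and adm: "admissible n \<theta> c"
    and finite_\<upsilon>: "finite \<upsilon>" and \<upsilon>_disjoint: "\<upsilon> \<inter> c ` {1..n} = {}"
begin

abbreviation "pos \<equiv> {i \<in> {1..n}. \<theta> i = 1}"
abbreviation "neg \<equiv> {i \<in> {1..n}. \<theta> i = -1}"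

lemma adm_less: "i \<in> {1..n} \<Longrightarrow> j \<in> {1..n} \<Longrightarrow> j < i \<Longrightarrow> c i = c j \<Longrightarrow> \<theta> i = 1 \<and> \<theta> j = -1"
  using adm unfolding admissible_def by blast

text \<open>Admissibility allows equal indices only with opposite signs. Within one sign, names
  determine positions, which is why relations on names lose no information.\<close>

lemma inj_on_sign: "inj_on c {i \<in> {1..n}. \<theta> i = s}"
proof (rule inj_onI)
  fix i j assume "i \<in> {i \<in> {1..n}. \<theta> i = s}" "j \<in> {i \<in> {1..n}. \<theta> i = s}" "c i = c j"
  then show "i = j"
    using adm_less[of i j] adm_less[of j i] by (cases i j rule: linorder_cases) auto
qed

lemma c_notin_\<upsilon>: "i \<in> {1..n} \<Longrightarrow> c i \<notin> \<upsilon>"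
  using \<upsilon>_disjoint by auto

end

lemma wick_sequence_Suc:
  assumes "wick_sequence (Suc n) \<theta> c \<upsilon>"
  shows "wick_sequence n \<theta> c \<upsilon>"
proof -
  interpret wick_sequence "Suc n" \<theta> c \<upsilon> by fact
  have sub: "i \<in> {1..Suc n}" if "i \<in> {1..n}" for i using that by simp
  show ?thesis
  proof
    show "admissible n \<theta> c"
      using adm_less sub unfolding admissible_def by blast
    show "\<upsilon> \<inter> c ` {1..n} = {}"
      using c_notin_\<upsilon> sub by blast
  qed (use signs sub finite_\<upsilon> in blast)+
qed

lemma wick_vars_Suc:
  "\<theta> (Suc n) = 1 \<Longrightarrow> wick_vars (Suc n) \<theta> c \<upsilon> = wick_vars n \<theta> c \<upsilon> \<union> {c (Suc n)}"
  "\<theta> (Suc n) = -1 \<Longrightarrow> wick_vars (Suc n) \<theta> c \<upsilon> = wick_vars n \<theta> c \<upsilon>"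
  by (simp_all add: wick_vars_def atLeastAtMost_Suc_Collect del: One_nat_def atLeastAtMost_iff)

text \<open>Creating an index that was annihilated before turns a parameter into a variable, hence
  the set difference in the first equation. The second needs the new index not to be a variable,
  since variables are subtracted from the parameters.\<close>

lemma wick_params_Suc:
  "\<theta> (Suc n) = 1 \<Longrightarrow> wick_params (Suc n) \<theta> c \<upsilon> = wick_params n \<theta> c \<upsilon> - {c (Suc n)}"
  "\<theta> (Suc n) = -1 \<Longrightarrow> c (Suc n) \<notin> wick_vars n \<theta> c \<upsilon> \<Longrightarrow>
    wick_params (Suc n) \<theta> c \<upsilon> = wick_params n \<theta> c \<upsilon> \<union> {c (Suc n)}"
  by (auto simp add: wick_params_def wick_vars_Suc atLeastAtMost_Suc_Collect simp del: One_nat_def atLeastAtMost_iff)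

text \<open>Absence of circuits comes from building the relation in the order of the operators: a
  creator only adds a free variable, and an annihilator adds an edge out of an index that has not
  occurred before.\<close>

lemma PhiE_term_contractions:
  assumes "wick_sequence n \<theta> c \<upsilon>" "S \<in> contractions n \<theta> c \<upsilon>"
  shows "PhiE_term (wick_vars n \<theta> c \<upsilon>) (wick_params n \<theta> c \<upsilon>) (wick_vars n \<theta> c \<upsilon> - Range S) S"
  using assms
proof (induction n arbitrary: S)
  case 0
  then show ?case
    by (auto simp: contractions_def PhiE_term_def wick_vars_def wick_params_def pair_set_def
        wick_sequence_def Domain_empty_iff acyclic_def)
next
  case (Suc n)
  interpret wick_sequence "Suc n" \<theta> c \<upsilon> by (rule Suc.prems)
  note IH = Suc.IH[OF wick_sequence_Suc[OF Suc.prems(1)]]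
  let ?c = "c (Suc n)" and ?\<pi> = "wick_vars n \<theta> c \<upsilon>"
  consider "\<theta> (Suc n) = 1" | "\<theta> (Suc n) = -1" using signs[rule_format, of "Suc n"] by auto
  then show ?case
  proof cases
    case 1
    have S: "S \<in> contractions n \<theta> c \<upsilon>"
      using Suc.prems(2) by (simp only: contractions_Suc_creation[where \<theta> = \<theta>, OF 1])
    \<comment> \<open>By admissibility an earlier operator with the same index is an annihilator, so
      the index may be a parameter but not a variable.\<close>
    have "?c \<notin> ?\<pi>"
      using adm_less[of "Suc n"] c_notin_\<upsilon>[of "Suc n"] by (force simp: wick_vars_def)
    moreover from this have "?c \<notin> Range S"
      using Range_contractions[OF S] by blast
    then have "wick_vars (Suc n) \<theta> c \<upsilon> - Range S = ?\<pi> - Range S \<union> {?c}"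
      by (auto simp: wick_vars_Suc(1)[where \<theta> = \<theta>, OF 1])
    ultimately show ?thesis
      using PhiE_term_insert[OF IH[OF S]]
      by (simp only: wick_vars_Suc(1)[where \<theta> = \<theta>, OF 1] wick_params_Suc(1)[where \<theta> = \<theta>, OF 1])
  next
    case 2
    \<comment> \<open>A repeated index would force the later of the two operators to be a
      creator.\<close>
    have new: "?c \<notin> c ` {1..n}"
      using adm_less[of "Suc n"] 2 by force
    then have c: "?c \<notin> ?\<pi>" "?c \<notin> ?\<pi> \<union> wick_params n \<theta> c \<upsilon>"
      using c_notin_\<upsilon>[of "Suc n"] by (auto simp: wick_vars_def wick_params_def)
    have "S \<in> (\<lambda>(S, b). S \<union> {(?c, b)}) ` (SIGMA S:contractions n \<theta> c \<upsilon>. ?\<pi> - Range S)"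
      using Suc.prems(2)
      by (simp only: contractions_Suc_annihilation(2)[where \<theta> = \<theta> and c = c and \<upsilon> = \<upsilon>, OF 2 new])
    then obtain S' b where S': "S' \<in> contractions n \<theta> c \<upsilon>" and b: "b \<in> ?\<pi> - Range S'"
      and S: "S = S' \<union> {(?c, b)}"
      by blast
    have "?\<pi> - Range S = ?\<pi> - Range S' - {b}" unfolding S by auto
    then show ?thesis
      using PhiE_term_contract[OF IH[OF S'] c(2) b] unfolding S
      by (simp only: wick_vars_Suc(2)[where \<theta> = \<theta>, OF 2]
          wick_params_Suc(2)[where \<theta> = \<theta>, OF 2 c(1)])
  qed
qed

text \<open>\<open>creation_mvec_sum\<close> leaves the set of relations alone, and
  \<open>annihilation_mvec_sum\<close> produces the index set that
  \<open>contractions_Suc_annihilation\<close> identifies with the contractions of the longer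
  sequence.\<close>

lemma monomial_eq_contractions:
  assumes "wick_sequence n \<theta> c \<upsilon>"
  shows "(monomial n \<theta> c (Phi \<upsilon>) :: ('i, 'x::t1_space) mvec) =
    mvec_sum (wick_vars n \<theta> c \<upsilon>) (wick_params n \<theta> c \<upsilon>) (contractions n \<theta> c \<upsilon>)
      (\<lambda>S. PhiE (wick_vars n \<theta> c \<upsilon> - Range S) S)"
  using assms
proof (induction n)
  case 0
  have eq: "wick_vars 0 \<theta> c \<upsilon> = \<upsilon>" "wick_params 0 \<theta> c \<upsilon> = {}" "contractions 0 \<theta> c \<upsilon> = {{}}"
    by (auto simp: wick_vars_def wick_params_def contractions_def Domain_empty_iff)
  have "PhiE_term \<upsilon> {} \<upsilon> ({} :: ('i \<times> 'i) set)"
    using PhiE_term_contractions[OF 0, of "{}"] by (simp add: eq)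
  then have meas: "measures_on \<upsilon> {} (Phi \<upsilon> :: ('i, 'x) mvec)"
    by (rule measures_on_PhiE)
  \<comment> \<open>The empty relation is the only contraction here; exposing the form
    \<open>mvec_on\<close> makes \<open>mvec_sum_singleton\<close> applicable.\<close>
  obtain F where F: "(Phi \<upsilon> :: ('i, 'x) mvec) = mvec_on \<upsilon> {} F"
    by (simp add: PhiE_def Let_def)
  have "mvec_sum \<upsilon> {} {{}} (\<lambda>S. PhiE (\<upsilon> - Range S) S) =
      (mvec_sum \<upsilon> {} {{}} (\<lambda>S :: ('i \<times> 'i) set. mvec_on \<upsilon> {} F) :: ('i, 'x) mvec)"
    by (intro mvec_sum_cong) (simp_all add: F)
  also have "\<dots> = mvec_on \<upsilon> {} F"
    by (rule mvec_sum_singleton) (use meas in \<open>simp only: F\<close>)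
  finally show ?case by (simp add: eq F)
next
  case (Suc n)
  interpret wick_sequence "Suc n" \<theta> c \<upsilon> by (rule Suc.prems)
  note W = wick_sequence_Suc[OF Suc.prems]
  note IH = Suc.IH[OF W]
  let ?c = "c (Suc n)" and ?\<pi> = "wick_vars n \<theta> c \<upsilon>" and ?\<rho> = "wick_params n \<theta> c \<upsilon>"
  let ?K = "contractions n \<theta> c \<upsilon>"
  have fin: "finite ?K" "finite ?\<pi>" "finite ?\<rho>" "?\<pi> \<inter> ?\<rho> = {}"
    using finite_\<upsilon> by (auto simp: finite_contractions wick_vars_def wick_params_def)
  consider "\<theta> (Suc n) = 1" | "\<theta> (Suc n) = -1" using signs[rule_format, of "Suc n"] by auto
  then show ?case
  proof cases
    case 1
    have c: "?c \<notin> ?\<pi>"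
      using adm_less[of "Suc n"] c_notin_\<upsilon>[of "Suc n"] by (force simp: wick_vars_def)
    have "(monomial (Suc n) \<theta> c (Phi \<upsilon>) :: ('i, 'x) mvec) =
        creation ?c (mvec_sum ?\<pi> ?\<rho> ?K (\<lambda>S. PhiE (?\<pi> - Range S) S))"
      by (simp add: IH ladder_def 1)
    also have "\<dots> = mvec_sum (?\<pi> \<union> {?c}) (?\<rho> - {?c}) ?K (\<lambda>S. PhiE (?\<pi> - Range S \<union> {?c}) S)"
      by (intro creation_mvec_sum fin c PhiE_term_contractions W)
    also have "\<dots> = mvec_sum (?\<pi> \<union> {?c}) (?\<rho> - {?c}) ?K (\<lambda>S. PhiE (?\<pi> \<union> {?c} - Range S) S)"
    proof (rule mvec_sum_cong[OF refl])
      fix S assume "S \<in> ?K"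
      then have "?c \<notin> Range S" using Range_contractions c by blast
      then have "?\<pi> - Range S \<union> {?c} = ?\<pi> \<union> {?c} - Range S" by blast
      then show "PhiE (?\<pi> - Range S \<union> {?c}) S = (PhiE (?\<pi> \<union> {?c} - Range S) S :: ('i, 'x) mvec)"
        by simp
    qed
    finally show ?thesis
      by (simp only: wick_vars_Suc(1)[where \<theta> = \<theta>, OF 1] wick_params_Suc(1)[where \<theta> = \<theta>, OF 1]
          contractions_Suc_creation[where \<theta> = \<theta>, OF 1])
  next
    case 2
    have new: "?c \<notin> c ` {1..n}"
      using adm_less[of "Suc n"] 2 by force
    then have c: "?c \<notin> ?\<pi>" "?c \<notin> ?\<pi> \<union> ?\<rho>"
      using c_notin_\<upsilon>[of "Suc n"] by (auto simp: wick_vars_def wick_params_def)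
    let ?f = "\<lambda>(S, b). S \<union> {(?c, b)}" and ?I = "SIGMA S:?K. ?\<pi> - Range S"
    note contr = contractions_Suc_annihilation[where \<theta> = \<theta> and c = c and \<upsilon> = \<upsilon>, OF 2 new]
    have "(monomial (Suc n) \<theta> c (Phi \<upsilon>) :: ('i, 'x) mvec) =
        annihilation ?c (mvec_sum ?\<pi> ?\<rho> ?K (\<lambda>S. PhiE (?\<pi> - Range S) S))"
      by (simp add: IH ladder_def 2)
    also have "\<dots> = mvec_sum ?\<pi> (?\<rho> \<union> {?c}) ?I
        (\<lambda>(S, b). PhiE (?\<pi> - Range S - {b}) (S \<union> {(?c, b)}))"
      by (intro annihilation_mvec_sum fin c PhiE_term_contractions W)
    also have "\<dots> = mvec_sum ?\<pi> (?\<rho> \<union> {?c}) ?I (\<lambda>j. PhiE (?\<pi> - Range (?f j)) (?f j))"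
    proof (intro mvec_sum_cong refl, clarify)
      fix S b
      have "?\<pi> - Range S - {b} = ?\<pi> - Range (S \<union> {(?c, b)})" by auto
      then show "PhiE (?\<pi> - Range S - {b}) (S \<union> {(?c, b)}) =
          (PhiE (?\<pi> - Range (S \<union> {(?c, b)})) (S \<union> {(?c, b)}) :: ('i, 'x) mvec)"
        by simp
    qed
    also have "\<dots> = mvec_sum ?\<pi> (?\<rho> \<union> {?c}) (?f ` ?I) (\<lambda>S. PhiE (?\<pi> - Range S) S)"
      by (rule mvec_sum_image[OF contr(1), symmetric])
    finally show ?thesis
      by (simp only: contr(2) wick_vars_Suc(2)[where \<theta> = \<theta>, OF 2]
          wick_params_Suc(2)[where \<theta> = \<theta>, OF 2 c(1)])
  qed
qed

section \<open>Wick terms indexed by complete contractions\<close>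

context wick_sequence
begin

text \<open>The triple sum on the right-hand side as one index set, nested as
  \<open>mvec_sum_Sigma\<close> produces it; \<open>fst (snd p)\<close> is the component
  \<open>B\<close> of the decomposition and \<open>fst u\<close> is
  \<open>\<upsilon>\<^sub>1\<close>.\<close>

definition term_indices ::
    "((nat set \<times> nat set \<times> (nat \<times> nat) set) \<times> ('i set \<times> 'i set) \<times> ('i \<Rightarrow> 'i)) set" where
  "term_indices = (SIGMA p:decompositions n \<theta>.
     SIGMA u:{(\<upsilon>\<^sub>1, \<upsilon>\<^sub>2). \<upsilon>\<^sub>1 \<union> \<upsilon>\<^sub>2 = \<upsilon> \<and> \<upsilon>\<^sub>1 \<inter> \<upsilon>\<^sub>2 = {}}. bijections (c ` fst (snd p)) (fst u))"

definition term_pairs ::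
    "(nat set \<times> nat set \<times> (nat \<times> nat) set) \<times> ('i set \<times> 'i set) \<times> ('i \<Rightarrow> 'i) \<Rightarrow> ('i \<times> 'i) set" where
  "term_pairs = (\<lambda>((A, B, Q), (\<upsilon>\<^sub>1, \<upsilon>\<^sub>2), h).
     (\<lambda>t. (t, h t)) ` c ` B \<union> (\<lambda>(q, r). (c q, c r)) ` Q)"

text \<open>The inverse of \<open>term_pairs\<close>: edges ending in \<open>\<upsilon>\<close>
  yield \<open>B\<close> and \<open>h\<close>, edges ending at a created index yield
  \<open>Q\<close>. The restriction makes \<open>h\<close> extensional, as \<open>bijections\<close>
  demands.\<close>

definition pairs_term ::
    "('i \<times> 'i) set \<Rightarrow> (nat set \<times> nat set \<times> (nat \<times> nat) set) \<times> ('i set \<times> 'i set) \<times> ('i \<Rightarrow> 'i)" where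
  "pairs_term S =
     (({s \<in> pos. c s \<notin> Range S}, {t \<in> neg. \<exists>e\<in>\<upsilon>. (c t, e) \<in> S},
       {(q, r). q \<in> neg \<and> r \<in> pos \<and> (c q, c r) \<in> S}),
      (Range S \<inter> \<upsilon>, \<upsilon> - Range S),
      restrict (\<lambda>t. THE e. (t, e) \<in> S) (c ` {t \<in> neg. \<exists>e\<in>\<upsilon>. (c t, e) \<in> S}))"

section \<open>Decompositions sorted by sign\<close>

lemma neg_pos_disjoint: "neg \<inter> pos = {}" "neg \<union> pos = {1..n}"
  using signs by auto

lemma c_eq_iff: "i \<in> neg \<Longrightarrow> j \<in> neg \<Longrightarrow> c i = c j \<longleftrightarrow> i = j"
  "i \<in> pos \<Longrightarrow> j \<in> pos \<Longrightarrow> c i = c j \<longleftrightarrow> i = j"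
  by (rule inj_on_eq_iff[OF inj_on_sign]; assumption)+

lemma c_pos_notin: "i \<in> pos \<Longrightarrow> c i \<notin> \<upsilon>"
  by (rule c_notin_\<upsilon>) simp

text \<open>Signs separate the first from the second components of \<open>Q\<close>. The partition
  of \<open>{1..n}\<close> thus splits into one of \<open>neg\<close> and one of \<open>pos\<close>,
  and disjointness of the pairs becomes injectivity of both projections.\<close>

lemma decompositionsD:
  assumes "(A, B, Q) \<in> decompositions n \<theta>"
  shows "A \<union> snd ` Q = pos" "A \<inter> snd ` Q = {}" "B \<union> fst ` Q = neg" "B \<inter> fst ` Q = {}"
    and "inj_on fst Q" "inj_on snd Q" "\<And>q r. (q, r) \<in> Q \<Longrightarrow> r < q"
proof -
  note d = assms[unfolded decompositions_def mem_Collect_eq prod.case]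
  from d have un: "A \<union> B \<union> (\<Union>(q, r)\<in>Q. {q, r}) = {1..n}" by (elim conjE)
  from d have Q_AB: "\<forall>(q, r)\<in>Q. {q, r} \<inter> (A \<union> B) = {}" by (elim conjE)
  from d have Q_Q: "\<forall>(q, r)\<in>Q. \<forall>(q', r')\<in>Q. (q, r) \<noteq> (q', r') \<longrightarrow> {q, r} \<inter> {q', r'} = {}"
    by (elim conjE)
  from d have A: "\<forall>s\<in>A. \<theta> s = 1" by (elim conjE)
  from d have B: "\<forall>s\<in>B. \<theta> s = -1" by (elim conjE)
  from d have Q: "\<forall>(q, r)\<in>Q. \<theta> q = -1 \<and> \<theta> r = 1 \<and> q > r" by (elim conjE)
  have mem: "i \<in> {1..n} \<longleftrightarrow> i \<in> A \<or> i \<in> B \<or> i \<in> fst ` Q \<or> i \<in> snd ` Q" for i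
    unfolding un[symmetric] by force
  have sgn: "\<theta> i = -1" if "i \<in> fst ` Q" for i using that Q by fastforce
  have sgn': "\<theta> i = 1" if "i \<in> snd ` Q" for i using that Q by fastforce
  have ne: "(1 :: int) \<noteq> -1" by simp
  show "A \<union> snd ` Q = pos"
  proof (intro set_eqI)
    fix i show "i \<in> A \<union> snd ` Q \<longleftrightarrow> i \<in> pos"
      unfolding Un_iff mem_Collect_eq using mem A B sgn sgn' ne by metis
  qed
  show "B \<union> fst ` Q = neg"
  proof (intro set_eqI)
    fix i show "i \<in> B \<union> fst ` Q \<longleftrightarrow> i \<in> neg"
      unfolding Un_iff mem_Collect_eq using mem A B sgn sgn' ne by metis
  qed
  show "A \<inter> snd ` Q = {}" "B \<inter> fst ` Q = {}"
    using Q_AB by fastforce+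
  show "inj_on fst Q" "inj_on snd Q"
    using Q_Q by (fastforce simp: inj_on_def)+
  show "\<And>q r. (q, r) \<in> Q \<Longrightarrow> r < q" using Q by blast
qed

lemma decompositionsI:
  assumes "A \<union> snd ` Q = pos" "A \<inter> snd ` Q = {}" "B \<union> fst ` Q = neg" "B \<inter> fst ` Q = {}"
    and "inj_on fst Q" "inj_on snd Q" "\<And>q r. (q, r) \<in> Q \<Longrightarrow> r < q"
  shows "(A, B, Q) \<in> decompositions n \<theta>"
proof -
  have sub: "A \<subseteq> pos" "B \<subseteq> neg" using assms(1,3) by auto
  have Q: "q \<in> neg - B" "r \<in> pos - A" if "(q, r) \<in> Q" for q r
  proof -
    have "q \<in> fst ` Q" "r \<in> snd ` Q" by (rule rev_image_eqI[OF that], simp)+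
    then show "q \<in> neg - B" "r \<in> pos - A" using assms(1-4) by blast+
  qed
  have "A \<union> B \<union> (\<Union>(q, r)\<in>Q. {q, r}) = (A \<union> snd ` Q) \<union> (B \<union> fst ` Q)"
    by force
  also have "\<dots> = {1..n}"
    unfolding assms(1,3) using neg_pos_disjoint by blast
  finally have un: "A \<union> B \<union> (\<Union>(q, r)\<in>Q. {q, r}) = {1..n}" .
  have Q_AB: "{q, r} \<inter> (A \<union> B) = {}" if "(q, r) \<in> Q" for q r
    using Q[OF that] sub neg_pos_disjoint(1) by blast
  have Q_Q: "{q, r} \<inter> {q', r'} = {}"
    if "(q, r) \<in> Q" "(q', r') \<in> Q" "(q, r) \<noteq> (q', r')" for q r q' r'
  proof -
    have "q \<noteq> q'" "r \<noteq> r'"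
      using that(3) inj_onD[OF assms(5) _ that(1,2)] inj_onD[OF assms(6) _ that(1,2)] by auto
    \<comment> \<open>These positions carry opposite signs.\<close>
    moreover have "q \<noteq> r'" "r \<noteq> q'"
      using Q[OF that(1)] Q[OF that(2)] by auto
    ultimately show ?thesis by simp
  qed
  have "A \<inter> B = {}" "\<forall>s\<in>A. \<theta> s = 1" "\<forall>s\<in>B. \<theta> s = -1"
    using sub neg_pos_disjoint(1) by blast+
  with un show ?thesis
    unfolding decompositions_def mem_Collect_eq prod.case
  proof (intro conjI)
    show "\<forall>(q, r)\<in>Q. {q, r} \<inter> (A \<union> B) = {}"
      by (intro ballI case_prodI2, rule Q_AB) simp
    show "\<forall>(q, r)\<in>Q. \<forall>(q', r')\<in>Q. (q, r) \<noteq> (q', r') \<longrightarrow> {q, r} \<inter> {q', r'} = {}"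
      by (intro ballI case_prodI2 impI, rule Q_Q) simp_all
    show "\<forall>(q, r)\<in>Q. \<theta> q = -1 \<and> \<theta> r = 1 \<and> q > r"
      using Q assms(7) by fast
  qed
qed

lemma finite_decompositions: "finite (decompositions n \<theta>)"
proof (rule finite_subset)
  show "decompositions n \<theta> \<subseteq> Pow {1..n} \<times> Pow {1..n} \<times> Pow ({1..n} \<times> {1..n})"
    by (auto simp: decompositions_def)
qed simp

section \<open>Passing between Wick terms and relations\<close>

lemma term_pairs_iff:
  "(b, e) \<in> term_pairs ((A, B, Q), (\<upsilon>\<^sub>1, \<upsilon>\<^sub>2), h) \<longleftrightarrow>
     (\<exists>t\<in>B. b = c t \<and> e = h (c t)) \<or> (\<exists>q r. (q, r) \<in> Q \<and> b = c q \<and> e = c r)"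
  by (auto simp: term_pairs_def)

text \<open>Edges from \<open>B\<close> end in \<open>\<upsilon>\<close> and edges from
  \<open>Q\<close> end at created indices, which lie outside \<open>\<upsilon>\<close>; so the two
  kinds can be told apart. Injectivity of \<open>c\<close> on each sign then recovers the
  positions.\<close>

lemma
  assumes "i = ((A, B, Q), (\<upsilon>\<^sub>1, \<upsilon>\<^sub>2), h)" "i \<in> term_indices"
  shows term_pairs_in_contractions: "term_pairs i \<in> contractions n \<theta> c \<upsilon>"
    and Range_term_pairs: "wick_vars n \<theta> c \<upsilon> - Range (term_pairs i) = c ` A \<union> \<upsilon>\<^sub>2"
    and pairs_term_term_pairs: "pairs_term (term_pairs i) = i"
proof -
  have d: "(A, B, Q) \<in> decompositions n \<theta>"
    and u: "\<upsilon>\<^sub>1 \<union> \<upsilon>\<^sub>2 = \<upsilon>" "\<upsilon>\<^sub>1 \<inter> \<upsilon>\<^sub>2 = {}" and h: "h \<in> extensional (c ` B)" "inj_on h (c ` B)" "h ` c ` B = \<upsilon>\<^sub>1"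
    using assms by (simp_all add: term_indices_def bijections_iff bij_betw_def)
  note D = decompositionsD[OF d]
  let ?S = "term_pairs i"
  note iff = term_pairs_iff[of _ _ A B Q \<upsilon>\<^sub>1 \<upsilon>\<^sub>2 h, folded assms(1)]
  have B: "t \<in> neg" "h (c t) \<in> \<upsilon>" if "t \<in> B" for t
    using that D(3) h(3) u(1) by auto
  have Q: "q \<in> neg" "r \<in> pos" "q \<notin> B" "r \<notin> A" "c r \<notin> \<upsilon>" if "(q, r) \<in> Q" for q r
  proof -
    have "q \<in> fst ` Q" "r \<in> snd ` Q" by (rule rev_image_eqI[OF that], simp)+
    then show "q \<in> neg" "r \<in> pos" "q \<notin> B" "r \<notin> A" using D(1-4) by blast+
    then show "c r \<notin> \<upsilon>" using c_pos_notin by blast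
  qed
  have Q_fun: "r = r'" if "(q, r) \<in> Q" "(q, r') \<in> Q" for q r r'
    using inj_onD[OF D(5), of "(q, r)" "(q, r')"] that by simp
  have Q_inj: "q = q'" if "(q, r) \<in> Q" "(q', r) \<in> Q" for q q' r
    using inj_onD[OF D(6), of "(q, r)" "(q', r)"] that by simp
  have S_cases: thesis
    if "(b, e) \<in> ?S" and "\<And>t. t \<in> B \<Longrightarrow> b = c t \<Longrightarrow> e = h (c t) \<Longrightarrow> thesis"
      and "\<And>q r. (q, r) \<in> Q \<Longrightarrow> b = c q \<Longrightarrow> e = c r \<Longrightarrow> thesis" for b e thesis
    using that unfolding iff by blast
  have S_\<upsilon>: "t \<in> B \<and> e = h (c t)" if "(c t, e) \<in> ?S" "e \<in> \<upsilon>" "t \<in> neg" for t e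
    using that(1)
  proof (rule S_cases)
    fix t' assume t': "t' \<in> B" "c t = c t'" "e = h (c t')"
    then have "t = t'" using c_eq_iff(1)[OF that(3) B(1)] by simp
    then show ?thesis using t' by simp
  qed (use Q(5) that(2) in blast)
  \<comment> \<open>The signs of \<open>q\<close> and \<open>r\<close> are essential: an annihilator
    and a later creator may share a name.\<close>
  have S_c: "(q, r) \<in> Q" if "(c q, c r) \<in> ?S" "q \<in> neg" "r \<in> pos" for q r
    using that(1)
  proof (rule S_cases)
    fix q' r' assume Q': "(q', r') \<in> Q" "c q = c q'" "c r = c r'"
    then have "q = q'" "r = r'"
      using c_eq_iff(1)[OF that(2) Q(1)] c_eq_iff(2)[OF that(3) Q(2)] by simp_all
    then show ?thesis using Q' by simp
  next
    fix t assume "t \<in> B" "c r = h (c t)"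
    then show ?thesis using B(2) c_pos_notin[OF that(3)] by simp
  qed
  have Range: "Range ?S = \<upsilon>\<^sub>1 \<union> c ` snd ` Q"
  proof -
    have "Range ?S = h ` c ` B \<union> c ` snd ` Q"
      by (force simp: assms(1) term_pairs_def)
    then show ?thesis by (simp add: h(3))
  qed
  have c_Range: "c s \<in> Range ?S \<longleftrightarrow> s \<in> snd ` Q" if "s \<in> pos" for s
  proof -
    have "snd ` Q \<subseteq> pos" using D(1) by blast
    then have "c s \<in> c ` snd ` Q \<longleftrightarrow> s \<in> snd ` Q"
      using that c_eq_iff(2) by blast
    moreover have "c s \<notin> \<upsilon>\<^sub>1" using c_pos_notin[OF that] u(1) by blast
    ultimately show ?thesis unfolding Range by blast
  qed
  have vars: "wick_vars n \<theta> c \<upsilon> = \<upsilon> \<union> c ` pos"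
    by (simp add: wick_vars_def)
  have cA: "c ` pos - c ` snd ` Q = c ` A"
  proof -
    have "c ` (pos - snd ` Q) = c ` pos - c ` snd ` Q"
      by (rule inj_on_image_set_diff[OF inj_on_sign]) (use D(1) in blast)+
    moreover have "pos - snd ` Q = A" using D(1,2) by blast
    ultimately show ?thesis by simp
  qed
  have disj: "c ` pos \<inter> \<upsilon> = {}" using c_pos_notin by blast
  show "wick_vars n \<theta> c \<upsilon> - Range ?S = c ` A \<union> \<upsilon>\<^sub>2"
  proof -
    have "c ` snd ` Q \<subseteq> c ` pos" using D(1) by blast
    then show ?thesis unfolding vars Range cA[symmetric] using u disj by blast
  qed
  have sv: "single_valued ?S"
  proof (rule single_valuedI)
    fix b e e' assume be: "(b, e) \<in> ?S" "(b, e') \<in> ?S"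
    show "e = e'"
    proof (rule S_cases[OF be(1)]; rule S_cases[OF be(2)])
      fix t t' assume "b = c t" "e = h (c t)" "b = c t'" "e' = h (c t')"
      then show "e = e'" by simp
    next
      \<comment> \<open>The mixed case is contradictory: \<open>t = q\<close> would lie both in
        \<open>B\<close> and among the first components of \<open>Q\<close>.\<close>
      fix t q r assume tq: "t \<in> B" "b = c t" "(q, r) \<in> Q" "b = c q"
      then have "t = q" using c_eq_iff(1)[OF B(1)[OF tq(1)] Q(1)[OF tq(3)]] by simp
      then show "e = e'" using tq Q(3) by blast
    next
      fix t q r assume tq: "t \<in> B" "b = c t" "(q, r) \<in> Q" "b = c q"
      then have "t = q" using c_eq_iff(1)[OF B(1)[OF tq(1)] Q(1)[OF tq(3)]] by simp
      then show "e = e'" using tq Q(3) by blast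
    next
      fix q r q' r' assume Q': "(q, r) \<in> Q" "b = c q" "e = c r" "(q', r') \<in> Q" "b = c q'" "e' = c r'"
      then have "q = q'" using c_eq_iff(1)[OF Q(1)[OF Q'(1)] Q(1)[OF Q'(4)]] by simp
      then show "e = e'" using Q' Q_fun by blast
    qed
  qed
  show "?S \<in> contractions n \<theta> c \<upsilon>"
  proof -
    have "Domain ?S = c ` (B \<union> fst ` Q)"
      by (force simp: assms(1) term_pairs_def)
    then have "Domain ?S = c ` neg" by (simp only: D(3))
    moreover note sv
    moreover have "single_valued (?S\<inverse>)"
    proof (rule single_valuedI)
      fix e b b' assume "(e, b) \<in> ?S\<inverse>" "(e, b') \<in> ?S\<inverse>"
      then have be: "(b, e) \<in> ?S" "(b', e) \<in> ?S" by simp_all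
      show "b = b'"
      proof (rule S_cases[OF be(1)]; rule S_cases[OF be(2)])
        fix t t' assume t: "t \<in> B" "b = c t" "e = h (c t)" "t' \<in> B" "b' = c t'" "e = h (c t')"
        then show "b = b'" using inj_onD[OF h(2), of "c t" "c t'"] by simp
      next
        fix q r q' r' assume Q': "(q, r) \<in> Q" "b = c q" "e = c r" "(q', r') \<in> Q" "b' = c q'" "e = c r'"
        then have "r = r'" using c_eq_iff(2)[OF Q(2)[OF Q'(1)] Q(2)[OF Q'(4)]] by simp
        then show "b = b'" using Q' Q_inj by blast
      \<comment> \<open>In the mixed cases the common target would lie both inside and outside
        \<open>\<upsilon>\<close>.\<close>
      qed (metis B(2) Q(5))+
    qed
    moreover have "e \<in> \<upsilon> \<or> (\<exists>q\<in>{1..n}. \<exists>r\<in>{1..n}. b = c q \<and> e = c r \<and> \<theta> q = -1 \<and> \<theta> r = 1 \<and> r < q)"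
      if "(b, e) \<in> ?S" for b e
      using that B(2) Q(1,2) D(7) unfolding iff by blast
    ultimately show ?thesis unfolding contractions_def by blast
  qed
  have "{s \<in> pos. c s \<notin> Range ?S} = A"
    using c_Range D(1,2) by blast
  moreover have B_eq: "{t \<in> neg. \<exists>e\<in>\<upsilon>. (c t, e) \<in> ?S} = B"
  proof (intro subset_antisym subsetI)
    fix t assume "t \<in> B"
    moreover from this have "(c t, h (c t)) \<in> ?S" unfolding iff by blast
    ultimately show "t \<in> {t \<in> neg. \<exists>e\<in>\<upsilon>. (c t, e) \<in> ?S}" using B by blast
  qed (use S_\<upsilon> in blast)
  moreover have "{(q, r). q \<in> neg \<and> r \<in> pos \<and> (c q, c r) \<in> ?S} = Q"
  proof (intro subset_antisym subrelI)
    fix q r assume "(q, r) \<in> Q"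
    moreover from this have "(c q, c r) \<in> ?S" unfolding iff by blast
    ultimately show "(q, r) \<in> {(q, r). q \<in> neg \<and> r \<in> pos \<and> (c q, c r) \<in> ?S}" using Q by blast
  qed (use S_c in blast)
  moreover have "Range ?S \<inter> \<upsilon> = \<upsilon>\<^sub>1" "\<upsilon> - Range ?S = \<upsilon>\<^sub>2"
  proof -
    have "c ` snd ` Q \<inter> \<upsilon> = {}" using D(1) disj by blast
    then show "Range ?S \<inter> \<upsilon> = \<upsilon>\<^sub>1" "\<upsilon> - Range ?S = \<upsilon>\<^sub>2" using u unfolding Range by blast+
  qed
  moreover have "restrict (\<lambda>t. THE e. (t, e) \<in> ?S) (c ` B) = h"
  proof (rule extensionalityI[OF restrict_extensional h(1)])
    fix b assume b: "b \<in> c ` B"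
    then have "(b, h b) \<in> ?S" unfolding iff by blast
    then have "(THE e. (b, e) \<in> ?S) = h b"
      using single_valuedD[OF sv] by (intro the_equality)
    then show "restrict (\<lambda>t. THE e. (t, e) \<in> ?S) (c ` B) b = h b" using b by simp
  qed
  ultimately show "pairs_term ?S = i"
    unfolding pairs_term_def by (simp only: assms(1))
qed

text \<open>Every target lies in \<open>\<upsilon>\<close> or is a created index, so no edge is lost
  when the relation is divided into \<open>h\<close> and \<open>Q\<close>. The two single-valuedness
  conditions make \<open>h\<close> a bijection and the projections of \<open>Q\<close>
  injective.\<close>

lemma
  assumes "S \<in> contractions n \<theta> c \<upsilon>"
  shows pairs_term_in_term_indices: "pairs_term S \<in> term_indices"
    and term_pairs_pairs_term: "term_pairs (pairs_term S) = S"
proof -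
  have Dom: "Domain S = c ` neg" and sv: "single_valued S" "single_valued (S\<inverse>)"
    and alt: "\<And>b e. (b, e) \<in> S \<Longrightarrow> e \<in> \<upsilon> \<or>
      (\<exists>q r. q \<in> neg \<and> r \<in> pos \<and> b = c q \<and> e = c r \<and> r < q)"
    using assms unfolding contractions_def by blast+
  have ex_snd: "\<exists>e. (c q, e) \<in> S" if "q \<in> neg" for q
  proof -
    have "c q \<in> Domain S" unfolding Dom using that by (rule imageI)
    then show ?thesis by (simp only: Domain_iff)
  qed
  have ex_neg: "\<exists>q\<in>neg. b = c q" if "(b, e) \<in> S" for b e
  proof -
    have "b \<in> c ` neg" unfolding Dom[symmetric] using that by (rule DomainI)
    then show ?thesis by (simp only: image_iff)
  qed
  define A B Q where "A = {s \<in> pos. c s \<notin> Range S}" and "B = {t \<in> neg. \<exists>e\<in>\<upsilon>. (c t, e) \<in> S}"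
    and "Q = {(q, r). q \<in> neg \<and> r \<in> pos \<and> (c q, c r) \<in> S}"
  define h where "h = restrict (\<lambda>t. THE e. (t, e) \<in> S) (c ` B)"
  have pt: "pairs_term S = ((A, B, Q), (Range S \<inter> \<upsilon>, \<upsilon> - Range S), h)"
    by (simp only: pairs_term_def A_def B_def Q_def h_def)
  have S_fun: "e = e'" if "(b, e) \<in> S" "(b, e') \<in> S" for b e e'
    using single_valuedD[OF sv(1) that] .
  have S_inj: "b = b'" if "(b, e) \<in> S" "(b', e) \<in> S" for b b' e
    using single_valuedD[OF sv(2), of e b b'] that by simp
  have h: "h b = e" if "b \<in> c ` B" "(b, e) \<in> S" for b e
    using that S_fun by (auto simp: h_def intro!: the_equality)
  have h': "(c t, h (c t)) \<in> S \<and> h (c t) \<in> \<upsilon>" if "t \<in> B" for t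
    using that h[of "c t"] by (auto simp: B_def)
  \<comment> \<open>A contraction only promises some pair of positions in the right order with these
    names; injectivity on each sign identifies that pair with \<open>q\<close> and
    \<open>r\<close>.\<close>
  have Q_I: "(q, r) \<in> Q \<and> r < q" if "(c q, c r) \<in> S" "q \<in> neg" "r \<in> pos" for q r
    using that alt[OF that(1)] c_pos_notin c_eq_iff unfolding Q_def by blast
  have Q_D: "(c q, c r) \<in> S" "q \<in> neg" "r \<in> pos" if "(q, r) \<in> Q" for q r
    using that by (simp_all add: Q_def)
  have "(A, B, Q) \<in> decompositions n \<theta>"
  proof (rule decompositionsI)
    have "r \<in> A \<or> r \<in> snd ` Q" if "r \<in> pos" for r
    proof (cases "c r \<in> Range S")
      case True
      then obtain b where b: "(b, c r) \<in> S" by blast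
      then obtain q where "b = c q" "q \<in> neg" using ex_neg by blast
      then have "(q, r) \<in> Q" using Q_I b that by blast
      then show ?thesis by force
    qed (use that in \<open>simp add: A_def\<close>)
    then show "A \<union> snd ` Q = pos" by (auto simp: A_def Q_def)
    show "A \<inter> snd ` Q = {}" by (auto simp: A_def Q_def)
    have "q \<in> B \<or> q \<in> fst ` Q" if "q \<in> neg" for q
    proof -
      obtain e where e: "(c q, e) \<in> S" using ex_snd \<open>q \<in> neg\<close> by blast
      show ?thesis
      proof (cases "e \<in> \<upsilon>")
        case True
        then show ?thesis using e that by (auto simp: B_def)
      next
        case False
        then obtain r where "r \<in> pos" "e = c r" using alt[OF e] by blast
        then have "(q, r) \<in> Q" using Q_I e that by blast
        then show ?thesis by force
      qed
    qed
    then show "B \<union> fst ` Q = neg" by (auto simp: B_def Q_def)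
    have False if "q \<in> B" "(q, r) \<in> Q" for q r
    proof -
      obtain e where "e \<in> \<upsilon>" "(c q, e) \<in> S" using \<open>q \<in> B\<close> by (auto simp: B_def)
      then show False using S_fun Q_D[OF that(2)] c_pos_notin by blast
    qed
    then show "B \<inter> fst ` Q = {}" by fastforce
    show "inj_on fst Q"
    proof (rule inj_onI)
      fix p p' assume p: "p \<in> Q" "p' \<in> Q" "fst p = fst p'"
      obtain q r r' where pp: "p = (q, r)" "p' = (q, r')" using p(3) by (metis prod.collapse)
      note qr = Q_D[OF p(1)[unfolded pp]] Q_D[OF p(2)[unfolded pp]]
      have "c r = c r'" using qr(1,4) by (rule S_fun)
      then show "p = p'" using c_eq_iff(2)[OF qr(3,6)] pp by simp
    qed
    show "inj_on snd Q"
    proof (rule inj_onI)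
      fix p p' assume p: "p \<in> Q" "p' \<in> Q" "snd p = snd p'"
      obtain q q' r where pp: "p = (q, r)" "p' = (q', r)" using p(3) by (metis prod.collapse)
      note qr = Q_D[OF p(1)[unfolded pp]] Q_D[OF p(2)[unfolded pp]]
      have "c q = c q'" using qr(1,4) by (rule S_inj)
      then show "p = p'" using c_eq_iff(1)[OF qr(2,5)] pp by simp
    qed
    show "\<And>q r. (q, r) \<in> Q \<Longrightarrow> r < q" using Q_I[OF Q_D] by blast
  qed
  moreover have "h \<in> bijections (c ` B) (Range S \<inter> \<upsilon>)"
  proof -
    have "inj_on h (c ` B)"
    proof (rule inj_onI, elim imageE)
      fix b b' t t' assume "h b = h b'" "b = c t" "t \<in> B" "b' = c t'" "t' \<in> B"
      then show "b = b'" using h'[of t] h'[of t'] S_inj by simp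
    qed
    moreover have "h ` c ` B = Range S \<inter> \<upsilon>"
    proof (intro subset_antisym subsetI)
      fix e assume e: "e \<in> Range S \<inter> \<upsilon>"
      then obtain t where "t \<in> neg" "(c t, e) \<in> S" using ex_neg by blast
      then show "e \<in> h ` c ` B" using h[of "c t" e] e by (force simp: B_def)
    qed (use h' in blast)
    ultimately show ?thesis by (simp add: bijections_iff bij_betw_def h_def)
  qed
  ultimately show "pairs_term S \<in> term_indices"
    unfolding pt term_indices_def by auto
  show "term_pairs (pairs_term S) = S"
  proof (rule set_eqI, clarify)
    fix b e
    show "(b, e) \<in> term_pairs (pairs_term S) \<longleftrightarrow> (b, e) \<in> S"
    proof
      assume "(b, e) \<in> term_pairs (pairs_term S)"
      then show "(b, e) \<in> S" unfolding pt term_pairs_iff using h' Q_D by blast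
    next
      assume be: "(b, e) \<in> S"
      show "(b, e) \<in> term_pairs (pairs_term S)"
      proof (cases "e \<in> \<upsilon>")
        case True
        obtain t where "t \<in> neg" "b = c t" using ex_neg[OF be] by blast
        then have "t \<in> B" using True be by (auto simp: B_def)
        then show ?thesis unfolding pt term_pairs_iff using h be \<open>b = c t\<close> by blast
      next
        case False
        then obtain q r where "q \<in> neg" "r \<in> pos" "b = c q" "e = c r" using alt[OF be] by blast
        then show ?thesis unfolding pt term_pairs_iff using Q_I be by blast
      qed
    qed
  qed
qed

lemma bij_betw_term_pairs: "bij_betw term_pairs term_indices (contractions n \<theta> c \<upsilon>)"
proof (rule bij_betw_byWitness[where f' = pairs_term])
  have tuple: "\<exists>A B Q \<upsilon>\<^sub>1 \<upsilon>\<^sub>2 h. i = ((A, B, Q), (\<upsilon>\<^sub>1, \<upsilon>\<^sub>2), h)"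
    for i :: "(nat set \<times> nat set \<times> (nat \<times> nat) set) \<times> ('i set \<times> 'i set) \<times> ('i \<Rightarrow> 'i)"
    by (metis prod.exhaust)
  show "\<forall>i\<in>term_indices. pairs_term (term_pairs i) = i"
    using tuple pairs_term_term_pairs by blast
  show "term_pairs ` term_indices \<subseteq> contractions n \<theta> c \<upsilon>"
    using tuple term_pairs_in_contractions by blast
qed (auto simp: pairs_term_in_term_indices term_pairs_pairs_term)

text \<open>The nested sums are flattened to one sum over \<open>term_indices\<close> and reindexed
  along the bijection \<open>term_pairs\<close>.\<close>

lemma sum_wick_terms:
  "(mvec_sum (wick_vars n \<theta> c \<upsilon>) (wick_params n \<theta> c \<upsilon>) (decompositions n \<theta>)
      (\<lambda>p. wick_term c p \<upsilon>) :: ('i, 'x::t1_space) mvec) =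
    mvec_sum (wick_vars n \<theta> c \<upsilon>) (wick_params n \<theta> c \<upsilon>) (contractions n \<theta> c \<upsilon>)
      (\<lambda>S. PhiE (wick_vars n \<theta> c \<upsilon> - Range S) S)"
proof -
  let ?\<pi> = "wick_vars n \<theta> c \<upsilon>" and ?\<rho> = "wick_params n \<theta> c \<upsilon>"
  let ?U = "{(\<upsilon>\<^sub>1, \<upsilon>\<^sub>2). \<upsilon>\<^sub>1 \<union> \<upsilon>\<^sub>2 = \<upsilon> \<and> \<upsilon>\<^sub>1 \<inter> \<upsilon>\<^sub>2 = {}}"
  let ?H = "\<lambda>p u. bijections (c ` fst (snd p)) (fst u)"
  let ?P = "\<lambda>i. PhiE (?\<pi> - Range (term_pairs i)) (term_pairs i) :: ('i, 'x) mvec"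
  have fin_U: "finite ?U"
    by (rule finite_subset[of _ "Pow \<upsilon> \<times> Pow \<upsilon>"]) (use finite_\<upsilon> in auto)
  have fin_H: "finite (?H p u)" if "p \<in> decompositions n \<theta>" "u \<in> ?U" for p u
  proof -
    have "fst (snd p) \<subseteq> {1..n}" using that(1) unfolding decompositions_def by auto
    moreover have "fst u \<subseteq> \<upsilon>" using that(2) by auto
    ultimately show ?thesis
      using finite_\<upsilon> by (intro finite_bijections finite_imageI) (auto intro: finite_subset)
  qed
  have meas: "measures_on ?\<pi> ?\<rho> (?P i)" if "i \<in> term_indices" for i
    using bij_betw_term_pairs that
    by (intro measures_on_PhiE PhiE_term_contractions wick_sequence_axioms) (auto dest: bij_betwE)
  have "wick_term c p \<upsilon> = mvec_sum ?\<pi> ?\<rho> ?U (\<lambda>u. mvec_sum ?\<pi> ?\<rho> (?H p u) (\<lambda>h. ?P (p, u, h)))"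
    if p: "p \<in> decompositions n \<theta>" for p
  proof -
    obtain A B Q where p_eq: "p = (A, B, Q)" by (metis prod.exhaust)
    note D = decompositionsD[OF p[unfolded p_eq]]
    let ?S = "(\<lambda>(q, r). (c q, c r)) ` Q"
    \<comment> \<open>The variables and parameters of a Wick term do not depend on the
      decomposition; only then do inner and outer sums agree on them, as flattening
      requires.\<close>
    have "c ` A \<union> \<upsilon> \<union> Range ?S = \<upsilon> \<union> c ` (A \<union> snd ` Q)" by force
    then have vars: "c ` A \<union> \<upsilon> \<union> Range ?S = ?\<pi>" by (simp only: D(1) wick_vars_def)
    have "c ` B \<union> Domain ?S = c ` (B \<union> fst ` Q)" by force
    then have params: "(c ` B \<union> Domain ?S) - ?\<pi> = ?\<rho>" by (simp only: D(3) wick_params_def)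
    have "wick_term c p \<upsilon> = mvec_sum ?\<pi> ?\<rho> ?U (\<lambda>(\<upsilon>\<^sub>1, \<upsilon>\<^sub>2). mvec_sum ?\<pi> ?\<rho> (bijections (c ` B) \<upsilon>\<^sub>1)
        (\<lambda>h. PhiE (c ` A \<union> \<upsilon>\<^sub>2) ((\<lambda>t. (t, h t)) ` c ` B \<union> ?S) :: ('i, 'x) mvec))"
      unfolding wick_term_def p_eq prod.case Let_def vars params ..
    also have "\<dots> = mvec_sum ?\<pi> ?\<rho> ?U (\<lambda>u. mvec_sum ?\<pi> ?\<rho> (?H p u) (\<lambda>h. ?P (p, u, h)))"
    proof (rule mvec_sum_cong[OF refl])
      fix u assume u: "u \<in> ?U"
      obtain \<upsilon>\<^sub>1 \<upsilon>\<^sub>2 where u_eq: "u = (\<upsilon>\<^sub>1, \<upsilon>\<^sub>2)" by (metis prod.exhaust)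
      have "PhiE (c ` A \<union> \<upsilon>\<^sub>2) ((\<lambda>t. (t, h t)) ` c ` B \<union> ?S) = ?P (p, u, h)"
        if h: "h \<in> bijections (c ` B) \<upsilon>\<^sub>1" for h
      proof -
        have "((A, B, Q), (\<upsilon>\<^sub>1, \<upsilon>\<^sub>2), h) \<in> term_indices"
          unfolding term_indices_def using p u h by (simp add: p_eq u_eq)
        from Range_term_pairs[OF refl this] show ?thesis
          by (simp add: term_pairs_def p_eq u_eq)
      qed
      then show "(case u of (\<upsilon>\<^sub>1, \<upsilon>\<^sub>2) \<Rightarrow> mvec_sum ?\<pi> ?\<rho> (bijections (c ` B) \<upsilon>\<^sub>1)
          (\<lambda>h. PhiE (c ` A \<union> \<upsilon>\<^sub>2) ((\<lambda>t. (t, h t)) ` c ` B \<union> ?S))) =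
        mvec_sum ?\<pi> ?\<rho> (?H p u) (\<lambda>h. ?P (p, u, h))"
        unfolding u_eq p_eq prod.case fst_conv snd_conv by (rule mvec_sum_cong[OF refl])
    qed
    finally show ?thesis .
  qed
  then have "mvec_sum ?\<pi> ?\<rho> (decompositions n \<theta>) (\<lambda>p. wick_term c p \<upsilon> :: ('i, 'x) mvec) =
      mvec_sum ?\<pi> ?\<rho> (decompositions n \<theta>) (\<lambda>p.
        mvec_sum ?\<pi> ?\<rho> ?U (\<lambda>u. mvec_sum ?\<pi> ?\<rho> (?H p u) (\<lambda>h. ?P (p, u, h))))"
    by (intro mvec_sum_cong refl)
  \<comment> \<open>Flattening goes from the inside out: first the splitting of
    \<open>\<upsilon>\<close> with \<open>h\<close>, then the decomposition.\<close>
  also have "\<dots> = mvec_sum ?\<pi> ?\<rho> (decompositions n \<theta>) (\<lambda>p.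
        mvec_sum ?\<pi> ?\<rho> (Sigma ?U (?H p)) (\<lambda>(u, h). ?P (p, u, h)))"
    using fin_U fin_H meas
    by (intro mvec_sum_cong refl mvec_sum_Sigma) (auto simp: term_indices_def)
  also have "\<dots> = mvec_sum ?\<pi> ?\<rho> term_indices (\<lambda>(p, u, h). ?P (p, u, h))"
    unfolding term_indices_def using fin_U fin_H meas
    by (intro mvec_sum_Sigma finite_decompositions finite_SigmaI) (auto simp: term_indices_def)
  also have "\<dots> = mvec_sum ?\<pi> ?\<rho> term_indices ?P"
    by (simp add: case_prod_unfold)
  also have "\<dots> = mvec_sum ?\<pi> ?\<rho> (contractions n \<theta> c \<upsilon>) (\<lambda>S. PhiE (?\<pi> - Range S) S)"
    by (rule mvec_sum_bij[OF bij_betw_term_pairs, symmetric])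
  finally show ?thesis .
qed

end

theorem theorem1p7p1:
  fixes n :: nat and \<theta> :: "nat \<Rightarrow> int" and c :: "nat \<Rightarrow> 'i" and \<upsilon> :: "'i set"
  assumes "locally compact (UNIV :: 'x::t2_space set)"
    and "countable_at_infinity TYPE('x)"
    and "\<forall>i\<in>{1..n}. \<theta> i = 1 \<or> \<theta> i = -1"
    and "admissible n \<theta> c"
    and "finite \<upsilon>" and "\<upsilon> \<inter> c ` {1..n} = {}"
  shows "monomial n \<theta> c (Phi \<upsilon> :: ('i, 'x) mvec) =
    mvec_sum (wick_vars n \<theta> c \<upsilon>) (wick_params n \<theta> c \<upsilon>) (decompositions n \<theta>)
      (\<lambda>p. wick_term c p \<upsilon>)"
proof -
  interpret wick_sequence n \<theta> c \<upsilon>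
    using assms(3-6) by unfold_locales
  show ?thesis
    unfolding sum_wick_terms by (rule monomial_eq_contractions[OF wick_sequence_axioms])
qed

end
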